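(* Let $\Omega\subsetneq\mathbb{R}^n$ be open, such that $-\Delta d\ge0$ in $\Omega$ in the sense of distributions, and such that $R:=\sup_{x\in\Omega}d(x)<\infty$. Then for all $u\in C_c^\infty(\Omega)$ and all $s>1$, $$\int_\Omega\frac{|\nabla u|}{d^{s-1}}dx\ \ge\ (s-1)\int_\Omega\frac{|u|}{d^s}dx+\frac{1}{R^{s-1}}\int_\Omega|\nabla u|\,dx.$$
   Context: $d(x):=\operatorname{dist}(x,\mathbb{R}^n\setminus\Omega)$. *)

theory Defs
  imports "HOL-Analysis.Analysis"
begin

definition partial_deriv :: "'a::euclidean_space \<Rightarrow> ('a \<Rightarrow> real) \<Rightarrow> 'a \<Rightarrow> real" where
  "partial_deriv b f x = frechet_derivative f (at x) b"

inductive_set iter_partials :: "('a::euclidean_space \<Rightarrow> real) \<Rightarrow> ('a \<Rightarrow> real) set"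
  for f where
  base: "f \<in> iter_partials f"
| step: "g \<in> iter_partials f \<Longrightarrow> b \<in> Basis \<Longrightarrow> partial_deriv b g \<in> iter_partials f"

definition smooth_on :: "('a::euclidean_space \<Rightarrow> real) \<Rightarrow> 'a set \<Rightarrow> bool" where
  "smooth_on f U \<longleftrightarrow> (\<forall>g\<in>iter_partials f. g differentiable_on U \<and> continuous_on U g)"

text \<open>u in C_c^infinity(Omega), identified with its extension by zero to the whole space.\<close>
definition test_fun :: "('a::euclidean_space \<Rightarrow> real) \<Rightarrow> 'a set \<Rightarrow> bool" where
  "test_fun u \<Omega> \<longleftrightarrow> smooth_on u UNIV \<and> compact (closure {x. u x \<noteq> 0})
      \<and> closure {x. u x \<noteq> 0} \<subseteq> \<Omega>"

definition grad :: "('a::euclidean_space \<Rightarrow> real) \<Rightarrow> 'a \<Rightarrow> 'a" where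
  "grad f x = (\<Sum>b\<in>Basis. partial_deriv b f x *\<^sub>R b)"

definition laplacian :: "('a::euclidean_space \<Rightarrow> real) \<Rightarrow> 'a \<Rightarrow> real" where
  "laplacian f x = (\<Sum>b\<in>Basis. partial_deriv b (partial_deriv b f) x)"

definition dist_bd :: "'a::euclidean_space set \<Rightarrow> 'a \<Rightarrow> real" where
  "dist_bd \<Omega> x = infdist x (- \<Omega>)"

definition superharmonic_distr :: "('a::euclidean_space \<Rightarrow> real) \<Rightarrow> 'a set \<Rightarrow> bool" where
  "superharmonic_distr f \<Omega> \<longleftrightarrow>
     (\<forall>\<phi>. test_fun \<phi> \<Omega> \<and> (\<forall>x. 0 \<le> \<phi> x) \<longrightarrow>
        (\<integral>x\<in>\<Omega>. f x * laplacian \<phi> x \<partial>lebesgue) \<le> 0)"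

end

theory Submission
  imports Defs
begin

text \<open>Put \<open>g t = t powr (1 - s) - R powr (1 - s)\<close>, which is nonnegative on \<open>(0, R]\<close> with
  \<open>g' t = (1 - s) * t powr - s\<close>. Testing \<open>- \<Delta> d \<ge> 0\<close> with \<open>\<bar>u\<bar> g(d)\<close> and integrating by parts gives
  \<open>0 \<le> \<integral> g(d) \<nabla>d \<bullet> \<nabla>\<bar>u\<bar> + \<integral> \<bar>u\<bar> g'(d) \<bar>\<nabla>d\<bar>\<^sup>2\<close>, and \<open>\<bar>\<nabla>d\<bar> = 1\<close> almost everywhere, so the
  first integral is at most \<open>\<integral> g(d) \<bar>\<nabla>u\<bar>\<close>. To make this rigorous, \<open>d\<close> is mollified (the mollification is
  smooth and superharmonic near the support of \<open>u\<close>, and its gradient converges wherever \<open>d\<close> is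
  differentiable) and \<open>\<bar>u\<bar>\<close> is replaced by \<open>sqrt (u\<^sup>2 + \<delta>\<^sup>2) - \<delta>\<close>. Almost everywhere differentiability of
  \<open>d\<close> follows from the convexity of \<open>\<bar>x\<bar>\<^sup>2 - d(x)\<^sup>2\<close>.\<close>

section \<open>A smooth bump function\<close>

text \<open>The natural test function \<open>\<bar>u\<bar> g(d)\<close> is only Lipschitz, while the
  hypothesis admits smooth test functions alone. Instead of enlarging that class, the proof tests
  once, with a rescaled bump centred at a point: this says that the mollified distance has
  nonpositive Laplacian there, and all later integration by parts concerns continuously
  differentiable functions and follows from translation invariance. The price is a limit in the
  radius of mollification. Second derivatives of the mollification have no uniform bound, but they
  enter only through the sign of the Laplacian; first derivatives are bounded uniformly because
  \<open>d\<close> is 1-Lipschitz, so their convergence almost everywhere suffices. The convexity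
  argument also names the gradient of \<open>d\<close>: it is \<open>(x - p) / d(x)\<close> for a
  nearest point \<open>p\<close>, so its length 1 costs nothing extra. The remainder term with
  \<open>R\<close> comes from the choice of \<open>g\<close>: \<open>R powr (1 - s)\<close> is the
  largest constant that can be subtracted from \<open>t powr (1 - s)\<close> while keeping it
  nonnegative on \<open>(0, R]\<close>, and nonnegativity is what lets the sign of the Laplacian be
  used.\<close>

definition exp_inv :: "nat \<Rightarrow> real \<Rightarrow> real" where
  "exp_inv k t = (if t > 0 then exp (- (1 / t)) / t ^ k else 0)"

lemma exp_inv_tendsto_0: "((\<lambda>t. exp (- (1 / t)) / t ^ k) \<longlongrightarrow> (0::real)) (at_right 0)"
proof -
  have "((\<lambda>t::real. (1 / t) ^ k / exp (1 / t)) \<longlongrightarrow> 0) (at_right 0)"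
    using filterlim_compose[OF tendsto_power_div_exp_0 filterlim_inverse_at_top_right, of k]
    by (simp add: inverse_eq_divide)
  then show ?thesis
    by (simp add: exp_minus field_simps)
qed

text \<open>The index \<open>k\<close> makes the family closed under differentiation up to linear
  combinations, so one derivative yields all of them. At 0 the right difference quotient is
  \<open>exp_inv (Suc k)\<close>, which tends to 0.\<close>

lemma exp_inv_has_derivative:
  "(exp_inv k has_real_derivative exp_inv (k + 2) t - real k * exp_inv (k + 1) t) (at t)"
proof (cases t "0::real" rule: linorder_cases)
  case less
  have "((\<lambda>_. 0) has_real_derivative 0) (at t)" by simp
  then have "(exp_inv k has_real_derivative 0) (at t)"
    by (rule has_field_derivative_transform_within_open[where S="{..<0}"])
      (use less in \<open>auto simp: exp_inv_def\<close>)
  then show ?thesis using less by (simp add: exp_inv_def)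
next
  case equal
  have "((\<lambda>h. exp_inv k h / h) \<longlongrightarrow> 0) (at_right 0)"
    by (rule Lim_transform_eventually[OF exp_inv_tendsto_0[of "Suc k"]])
      (auto simp: exp_inv_def eventually_at_right_less intro!: eventually_mono[OF eventually_at_right_less])
  moreover have "((\<lambda>h. exp_inv k h / h) \<longlongrightarrow> 0) (at_left 0)"
    by (rule Lim_transform_eventually[OF tendsto_const])
      (auto simp: exp_inv_def eventually_at_filter)
  ultimately have "((\<lambda>h. exp_inv k h / h) \<longlongrightarrow> 0) (at 0)"
    by (simp add: filterlim_split_at)
  then show ?thesis using equal
    by (simp add: has_field_derivative_iff exp_inv_def)
next
  case greater
  have "((\<lambda>t. exp (- (1 / t)) / t ^ k) has_real_derivative
      (exp (- (1 / t)) * (1 / t\<^sup>2) * t ^ k - exp (- (1 / t)) * (real k * t ^ (k - Suc 0))) / (t ^ k * t ^ k))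
      (at t)"
    using greater by (auto intro!: derivative_eq_intros simp: power2_eq_square)
  \<comment> \<open>For \<open>k = 0\<close> the truncated exponent does no harm, since the factor
    \<open>real k\<close> vanishes.\<close>
  moreover have "real k * t ^ (k - Suc 0) = real k * t ^ k / t"
    using greater by (cases k) auto
  ultimately have "((\<lambda>t. exp (- (1 / t)) / t ^ k) has_real_derivative
      exp_inv (k + 2) t - real k * exp_inv (k + 1) t) (at t)"
    using greater
    by (elim DERIV_cong) (simp add: exp_inv_def divide_simps power2_eq_square, auto simp: algebra_simps)
  then show ?thesis
    by (rule has_field_derivative_transform_within_open[where S="{0<..}"])
      (use greater in \<open>auto simp: exp_inv_def\<close>)
qed

text \<open>\<open>smooth_on\<close> quantifies over all iterated partial derivatives, so an
  invariant closed under differentiation is needed. Products with coordinates are included because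
  \<open>1 - z \<bullet> z\<close> has derivative \<open>-2 * (z \<bullet> h)\<close>. All members
  vanish off the unit ball.\<close>

inductive_set bump_class :: "('a::euclidean_space \<Rightarrow> real) set" where
  bump: "(\<lambda>z. exp_inv k (1 - z \<bullet> z)) \<in> bump_class"
| coord: "f \<in> bump_class \<Longrightarrow> (\<lambda>z. (z \<bullet> b) * f z) \<in> bump_class"
| scale: "f \<in> bump_class \<Longrightarrow> (\<lambda>z. a * f z) \<in> bump_class"
| add: "f \<in> bump_class \<Longrightarrow> g \<in> bump_class \<Longrightarrow> (\<lambda>z. f z + g z) \<in> bump_class"

lemma bump_class_derivative:
  assumes "f \<in> bump_class"
  shows "\<exists>f'. (\<forall>z. (f has_derivative f' z) (at z)) \<and> (\<forall>h. (\<lambda>z. f' z h) \<in> bump_class)"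
  using assms
proof induction
  case (bump k)
  define e where "e t = exp_inv (k + 2) t - real k * exp_inv (k + 1) t" for t
  have "((\<lambda>z. exp_inv k (1 - z \<bullet> z)) has_derivative (\<lambda>h. (-2 * (z \<bullet> h)) * e (1 - z \<bullet> z))) (at z)"
    for z :: 'a
  proof -
    have "((\<lambda>z. 1 - z \<bullet> z) has_derivative (\<lambda>h. - 2 * (z \<bullet> h))) (at z)"
      by (auto intro!: derivative_eq_intros simp: inner_commute)
    from has_derivative_compose[OF this,
        OF exp_inv_has_derivative[of k "1 - z \<bullet> z", unfolded has_field_derivative_def]]
    show ?thesis by (simp only: e_def mult.commute)
  qed
  moreover have "(\<lambda>z. (-2 * (z \<bullet> h)) * e (1 - z \<bullet> z)) \<in> bump_class" for h :: 'a
  proof -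
    have "(\<lambda>z. -2 * ((z \<bullet> h) * (exp_inv (k + 2) (1 - z \<bullet> z) + (- real k) * exp_inv (k + 1) (1 - z \<bullet> z)))) \<in> bump_class"
      by (intro bump_class.intros)
    also have "(\<lambda>z. -2 * ((z \<bullet> h) * (exp_inv (k + 2) (1 - z \<bullet> z) + (- real k) * exp_inv (k + 1) (1 - z \<bullet> z))))
        = (\<lambda>z. (-2 * (z \<bullet> h)) * e (1 - z \<bullet> z))"
      by (simp add: e_def fun_eq_iff)
    finally show ?thesis .
  qed
  ultimately show ?case
    by (intro exI[of _ "\<lambda>z h. (-2 * (z \<bullet> h)) * e (1 - z \<bullet> z)"]) blast
next
  case (coord f b)
  then obtain f' where f': "\<And>z. (f has_derivative f' z) (at z)" "\<And>h. (\<lambda>z. f' z h) \<in> bump_class"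
    by blast
  have "((\<lambda>z. (z \<bullet> b) * f z) has_derivative (\<lambda>h. (h \<bullet> b) * f z + (z \<bullet> b) * f' z h)) (at z)" for z
    by (auto intro!: derivative_eq_intros f')
  moreover have "(\<lambda>z. (h \<bullet> b) * f z + (z \<bullet> b) * f' z h) \<in> bump_class" for h
    by (intro bump_class.intros f' coord)
  ultimately show ?case by (intro exI[of _ "\<lambda>z h. (h \<bullet> b) * f z + (z \<bullet> b) * f' z h"]) blast
next
  case (scale f a)
  then obtain f' where f': "\<And>z. (f has_derivative f' z) (at z)" "\<And>h. (\<lambda>z. f' z h) \<in> bump_class"
    by blast
  then show ?case
    by (intro exI[of _ "\<lambda>z h. a * f' z h"]) (auto intro!: derivative_eq_intros bump_class.intros)
next
  case (add f g)
  then obtain f' g' where f': "\<And>z. (f has_derivative f' z) (at z)" "\<And>h. (\<lambda>z. f' z h) \<in> bump_class"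
    and g': "\<And>z. (g has_derivative g' z) (at z)" "\<And>h. (\<lambda>z. g' z h) \<in> bump_class"
    by blast
  then show ?case
    by (intro exI[of _ "\<lambda>z h. f' z h + g' z h"]) (auto intro!: derivative_eq_intros bump_class.intros)
qed

lemma bump_class_has_derivative:
  assumes "f \<in> bump_class"
  shows "(f has_derivative (\<lambda>h. partial_deriv h f z)) (at z)"
  using bump_class_derivative[OF assms] frechet_derivative_at
  unfolding partial_deriv_def by (metis (no_types, lifting) eta_contract_eq)

lemma bump_class_partial:
  assumes "f \<in> bump_class"
  shows "partial_deriv h f \<in> bump_class"
proof -
  obtain f' where f': "\<And>z. (f has_derivative f' z) (at z)" "\<And>h. (\<lambda>z. f' z h) \<in> bump_class"
    using bump_class_derivative[OF assms] by blast
  then have "partial_deriv h f = (\<lambda>z. f' z h)"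
    unfolding partial_deriv_def by (metis frechet_derivative_at)
  then show ?thesis using f' by simp
qed

lemma bump_class_continuous:
  assumes "f \<in> bump_class" shows "continuous_on A f"
  by (meson assms bump_class_has_derivative continuous_at_imp_continuous_on has_derivative_continuous)

lemma bump_class_eq_0:
  assumes "f \<in> bump_class" "norm z \<ge> 1" shows "f z = 0"
  using assms
proof induction
  case (bump k)
  then have "z \<bullet> z \<ge> 1" by (simp add: dot_square_norm)
  then show ?case by (simp add: exp_inv_def)
qed auto

definition bump :: "'a::euclidean_space \<Rightarrow> real" where
  "bump z = exp_inv 0 (1 - z \<bullet> z)"

lemma bump_in_class: "bump \<in> bump_class"
  using bump_class.bump[of 0] by (simp add: bump_def[abs_def])

lemma bump_nonneg: "0 \<le> bump z"
  by (simp add: bump_def exp_inv_def)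

lemma bump_pos_iff: "0 < bump z \<longleftrightarrow> norm z < 1"
  by (auto simp: bump_def exp_inv_def dot_square_norm power_less_one_iff abs_square_less_1)

text \<open>The reflected argument is that of a convolution kernel seen as a function of the
  integration variable. The free factor \<open>a\<close> absorbs the \<open>- 1 / e\<close> produced
  by each differentiation.\<close>

lemma smooth_on_bump_reflect_scale:
  fixes x :: "'a::euclidean_space"
  assumes "f \<in> bump_class"
  shows "smooth_on (\<lambda>z. f ((1 / e) *\<^sub>R (x - z))) UNIV"
    and "partial_deriv b (\<lambda>z. a * f ((1 / e) *\<^sub>R (x - z))) =
      (\<lambda>z. - (a / e) * partial_deriv b f ((1 / e) *\<^sub>R (x - z)))"
proof -
  have der: "((\<lambda>z. a * f ((1 / e) *\<^sub>R (x - z))) has_derivative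
      (\<lambda>h. - (a / e) * partial_deriv h f ((1 / e) *\<^sub>R (x - z)))) (at z)"
    if "f \<in> bump_class" for f :: "'a \<Rightarrow> real" and a z
  proof -
    have "((\<lambda>z. f ((1 / e) *\<^sub>R (x - z))) has_derivative
      (\<lambda>h. partial_deriv ((- (1 / e)) *\<^sub>R h) f ((1 / e) *\<^sub>R (x - z)))) (at z)"
      by (rule has_derivative_compose[of _ "\<lambda>h. (- (1 / e)) *\<^sub>R h" z UNIV f])
        (auto intro!: derivative_eq_intros bump_class_has_derivative[OF that])
    moreover have "partial_deriv ((- (1 / e)) *\<^sub>R h) f y = - (1 / e) * partial_deriv h f y" for h y
      using linear_cmul[OF has_derivative_linear[OF bump_class_has_derivative[OF that, of y]], of "- (1 / e)" h]
      by simp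
    ultimately show ?thesis
      by (auto intro!: derivative_eq_intros simp: mult_ac)
  qed
  have pd: "partial_deriv b (\<lambda>z. a * f ((1 / e) *\<^sub>R (x - z))) =
      (\<lambda>z. - (a / e) * partial_deriv b f ((1 / e) *\<^sub>R (x - z)))"
    if "f \<in> bump_class" for f :: "'a \<Rightarrow> real" and a b
  proof
    fix z
    show "partial_deriv b (\<lambda>z. a * f ((1 / e) *\<^sub>R (x - z))) z = - (a / e) * partial_deriv b f ((1 / e) *\<^sub>R (x - z))"
      unfolding partial_deriv_def[of b "\<lambda>z. a * f ((1 / e) *\<^sub>R (x - z))"]
      by (rule fun_cong[OF frechet_derivative_at[OF der[OF that], symmetric]])
  qed
  show "partial_deriv b (\<lambda>z. a * f ((1 / e) *\<^sub>R (x - z))) =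
      (\<lambda>z. - (a / e) * partial_deriv b f ((1 / e) *\<^sub>R (x - z)))"
    by (rule pd[OF assms])
  have *: "\<exists>a. \<exists>f\<in>bump_class. g = (\<lambda>z. a * f ((1 / e) *\<^sub>R (x - z)))"
    if "g \<in> iter_partials (\<lambda>z. f ((1 / e) *\<^sub>R (x - z)))" for g
    using that
  proof induction
    case base
    show ?case by (rule exI[of _ 1], rule bexI[OF _ assms]) simp
  next
    case (step g b)
    then obtain a f' where f': "f' \<in> bump_class" "g = (\<lambda>z. a * f' ((1 / e) *\<^sub>R (x - z)))"
      by blast
    show ?case
      unfolding f'(2) pd[OF f'(1)] using bump_class_partial[OF f'(1), of b] by blast
  qed
  show "smooth_on (\<lambda>z. f ((1 / e) *\<^sub>R (x - z))) UNIV"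
    unfolding smooth_on_def
  proof
    fix g assume "g \<in> iter_partials (\<lambda>z. f ((1 / e) *\<^sub>R (x - z)))"
    from *[OF this] obtain a f' where f': "f' \<in> bump_class" "g = (\<lambda>z. a * f' ((1 / e) *\<^sub>R (x - z)))"
      by blast
    then have "g differentiable_on UNIV"
      unfolding f'(2) differentiable_on_def differentiable_def using der[OF f'(1)] by blast
    then show "g differentiable_on UNIV \<and> continuous_on UNIV g"
      using differentiable_imp_continuous_on by blast
  qed
qed

section \<open>Integration by parts along a direction\<close>

lemma integral_translation:
  fixes f :: "'a::euclidean_space \<Rightarrow> real"
  assumes [measurable]: "f \<in> borel_measurable borel"
  shows "(\<integral>x. f (x + c) \<partial>lborel) = (\<integral>x. f x \<partial>lborel)"
proof -
  have "(\<integral>x. f x \<partial>lborel) = (\<integral>x. f x \<partial>distr lborel borel ((+) c))"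
    by (simp add: lborel_distr_plus)
  also have "\<dots> = (\<integral>x. f (c + x) \<partial>lborel)"
    by (subst integral_distr) auto
  finally show ?thesis by (simp add: add.commute)
qed

lemma integrable_translation:
  fixes f :: "'a::euclidean_space \<Rightarrow> real"
  assumes "integrable lborel f"
  shows "integrable lborel (\<lambda>x. f (x + c))"
proof -
  have [measurable]: "f \<in> borel_measurable borel"
    using assms by auto
  have "integrable (distr lborel borel ((+) c)) f"
    using assms by (simp add: lborel_distr_plus)
  then show ?thesis
    by (subst (asm) integrable_distr_eq) (auto simp: add.commute)
qed

lemma integrable_compact_support:
  fixes f :: "'a::euclidean_space \<Rightarrow> real"
  assumes "compact K" "continuous_on K f" "\<And>x. x \<notin> K \<Longrightarrow> f x = 0"
  shows "integrable lborel f" "f \<in> borel_measurable borel" "\<exists>C\<ge>0. \<forall>x. \<bar>f x\<bar> \<le> C"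
proof -
  have eq: "f = (\<lambda>x. indicator K x *\<^sub>R f x)"
    using assms(3) by (auto simp: indicator_def fun_eq_iff)
  show int: "integrable lborel f"
    by (subst eq) (rule borel_integrable_compact[OF assms(1,2)])
  then show "f \<in> borel_measurable borel" by auto
  have "bounded (f ` K)"
    using assms compact_continuous_image compact_imp_bounded by blast
  then obtain C where "\<And>x. x \<in> K \<Longrightarrow> \<bar>f x\<bar> \<le> C"
    by (auto simp: bounded_iff)
  then have "\<bar>f x\<bar> \<le> max C 0" for x
    using assms(3)[of x] by (cases "x \<in> K") (auto simp: max.coboundedI1)
  then show "\<exists>C\<ge>0. \<forall>x. \<bar>f x\<bar> \<le> C"
    by (intro exI[of _ "max C 0"]) auto
qed

lemma directional_deriv_bound:
  fixes h :: "'a::euclidean_space \<Rightarrow> real"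
  assumes "\<And>x. ((\<lambda>t. h (x + t *\<^sub>R b)) has_real_derivative h' x) (at 0)" "\<And>x. \<bar>h' x\<bar> \<le> C"
  shows "\<bar>h (x + t *\<^sub>R b) - h x\<bar> \<le> C * \<bar>t\<bar>"
proof -
  \<comment> \<open>A derivative at parameter 0 through every base point gives one at every
    parameter: move the base point along the line.\<close>
  have der: "((\<lambda>t. h (x + t *\<^sub>R b)) has_real_derivative h' (x + t *\<^sub>R b)) (at t)" for t
  proof -
    have "((\<lambda>r. h ((x + t *\<^sub>R b) + (r - t) *\<^sub>R b)) has_real_derivative h' (x + t *\<^sub>R b)) (at t)"
      using DERIV_shift[of "\<lambda>r. h ((x + t *\<^sub>R b) + r *\<^sub>R b)" "h' (x + t *\<^sub>R b)" t "- t"] assms(1)[of "x + t *\<^sub>R b"]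
      by simp
    then show ?thesis by (simp add: algebra_simps)
  qed
  show ?thesis
    using field_differentiable_bound[of UNIV "\<lambda>t. h (x + t *\<^sub>R b)" "\<lambda>t. h' (x + t *\<^sub>R b)" C t 0]
      der assms(2) by simp
qed

lemma directional_deriv_limit:
  fixes h :: "'a::real_normed_vector \<Rightarrow> real"
  assumes "((\<lambda>t. h (x + t *\<^sub>R b)) has_real_derivative D) (at 0)"
    and "e \<longlonglongrightarrow> 0" "\<And>n. e n \<noteq> 0"
  shows "(\<lambda>n. (h (x + e n *\<^sub>R b) - h x) / e n) \<longlonglongrightarrow> D"
proof -
  have "((\<lambda>t. (h (x + t *\<^sub>R b) - h x) / t) \<longlongrightarrow> D) (at 0)"
    using assms(1) by (simp add: has_field_derivative_iff)
  moreover have "filterlim e (at 0) sequentially"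
    using assms(2,3) by (simp add: filterlim_at)
  ultimately show ?thesis by (rule filterlim_compose)
qed

lemma directional_deriv_outside:
  fixes h :: "'a::real_normed_vector \<Rightarrow> real"
  assumes "closed K" "x \<notin> K" "\<And>x. x \<notin> K \<Longrightarrow> h x = 0"
  shows "((\<lambda>t. h (x + t *\<^sub>R b)) has_real_derivative 0) (at 0)"
proof -
  have "open ((\<lambda>t. x + t *\<^sub>R b) -` (- K))"
    by (intro open_vimage continuous_intros) (use assms(1) in auto)
  moreover have "((\<lambda>_. 0) has_real_derivative 0) (at (0::real))" by simp
  ultimately show ?thesis
    by (elim has_field_derivative_transform_within_open) (use assms in auto)
qed

text \<open>Dominated convergence: the quotients are bounded by a bound on \<open>h'\<close> and
  supported in a fixed ball. The steps may have either sign, and \<open>F\<close> need only be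
  continuous, so derivatives can be taken off a rough factor.\<close>

lemma difference_quotient_integral_limit:
  fixes h :: "'a::euclidean_space \<Rightarrow> real"
  assumes K: "compact K" and h: "continuous_on K h" "\<And>x. x \<notin> K \<Longrightarrow> h x = 0"
    and h': "continuous_on K h'" "\<And>x. x \<notin> K \<Longrightarrow> h' x = 0"
    and der: "\<And>x. x \<in> K \<Longrightarrow> ((\<lambda>t. h (x + t *\<^sub>R b)) has_real_derivative h' x) (at 0)"
    and F: "continuous_on UNIV F" and e: "e \<longlonglongrightarrow> 0" "\<And>n. e n \<noteq> 0"
  shows "(\<lambda>n. \<integral>x. F x * ((h (x + e n *\<^sub>R b) - h x) / e n) \<partial>lborel) \<longlonglongrightarrow> (\<integral>x. F x * h' x \<partial>lborel)"
proof -
  note int_h = integrable_compact_support[OF K h]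
  note int_h' = integrable_compact_support[OF K h']
  note [measurable] = int_h(2) int_h'(2) borel_measurable_continuous_onI[OF F]
  obtain C where C: "C \<ge> 0" "\<And>x. \<bar>h' x\<bar> \<le> C" using int_h'(3) by blast
  have der': "((\<lambda>t. h (x + t *\<^sub>R b)) has_real_derivative h' x) (at 0)" for x
    using der[of x] directional_deriv_outside[of K x h] h(2) h'(2)[of x] compact_imp_closed[OF K]
    by (cases "x \<in> K") auto
  note bd = directional_deriv_bound[of h b h' C, OF der' C(2)]
  obtain B where B: "\<And>x. x \<in> K \<Longrightarrow> norm x \<le> B"
    using compact_imp_bounded[OF K] by (auto simp: bounded_iff)
  obtain E where E: "\<And>n. \<bar>e n\<bar> \<le> E"
    using convergent_imp_Bseq[of e] e(1) unfolding convergent_def Bseq_def by auto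
  then have "E \<ge> 0" by (meson abs_ge_zero order_trans)
  define q where "q n x = (h (x + e n *\<^sub>R b) - h x) / e n" for n x
  \<comment> \<open>\<open>B\<close> bounds \<open>K\<close> and \<open>E\<close> bounds the step
    sizes, so for \<open>x\<close> outside this ball neither \<open>x\<close> nor its shift meets
    \<open>K\<close>.\<close>
  define w where "w x = indicator (cball 0 (B + E * norm b)) x *\<^sub>R (\<bar>F x\<bar> * C)" for x :: 'a
  have "(\<lambda>n. \<integral>x. F x * q n x \<partial>lborel) \<longlonglongrightarrow> (\<integral>x. F x * h' x \<partial>lborel)"
  proof (rule integral_dominated_convergence[where w=w])
    show "integrable lborel w"
      unfolding w_def
      by (rule borel_integrable_compact) (auto intro!: continuous_intros continuous_on_subset[OF F])
    show "AE x in lborel. (\<lambda>n. F x * q n x) \<longlonglongrightarrow> F x * h' x"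
      unfolding q_def using directional_deriv_limit[OF der' e] by (intro AE_I2 tendsto_mult_left)
    have "\<bar>F x * q n x\<bar> \<le> w x" for n x
    proof (cases "norm x \<le> B + E * norm b")
      case True
      have "\<bar>q n x\<bar> = \<bar>h (x + e n *\<^sub>R b) - h x\<bar> / \<bar>e n\<bar>"
        by (simp add: q_def)
      also have "\<dots> \<le> C * \<bar>e n\<bar> / \<bar>e n\<bar>"
        using bd[of x "e n"] by (intro divide_right_mono) auto
      finally show ?thesis using True e(2)[of n] by (simp add: w_def abs_mult mult_left_mono)
    next
      case False
      have "norm (e n *\<^sub>R b) \<le> E * norm b"
        using mult_right_mono[OF E[of n], of "norm b"] by simp
      moreover have "norm x \<le> norm (x + e n *\<^sub>R b) + norm (e n *\<^sub>R b)"
        using norm_triangle_ineq4[of "x + e n *\<^sub>R b" "e n *\<^sub>R b"] by simp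
      moreover have "0 \<le> E * norm b" using \<open>E \<ge> 0\<close> by simp
      ultimately have "norm (x + e n *\<^sub>R b) > B" "norm x > B"
        using False by linarith+
      then have "x + e n *\<^sub>R b \<notin> K" "x \<notin> K" using B by force+
      then show ?thesis using h(2) C(1) by (simp add: q_def w_def)
    qed
    then show "AE x in lborel. norm (F x * q n x) \<le> w x" for n by simp
  qed (auto simp: q_def)
  then show ?thesis by (simp add: q_def)
qed

lemma LIMSEQ_inverse_Suc: "(\<lambda>n. 1 / real (Suc n)) \<longlonglongrightarrow> 0"
  using LIMSEQ_inverse_real_of_nat by (simp add: inverse_eq_divide)

text \<open>Translation invariance makes the integral of every difference quotient vanish.\<close>

lemma integral_directional_deriv_eq_0:
  fixes h :: "'a::euclidean_space \<Rightarrow> real"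
  assumes K: "compact K" and h: "continuous_on K h" "\<And>x. x \<notin> K \<Longrightarrow> h x = 0"
    and h': "continuous_on K h'" "\<And>x. x \<notin> K \<Longrightarrow> h' x = 0"
    and der: "\<And>x. x \<in> K \<Longrightarrow> ((\<lambda>t. h (x + t *\<^sub>R b)) has_real_derivative h' x) (at 0)"
  shows "(\<integral>x. h' x \<partial>lborel) = 0"
proof -
  note int_h = integrable_compact_support[OF K h]
  define e where "e n = 1 / real (Suc n)" for n
  have e: "e \<longlonglongrightarrow> 0" "\<And>n. e n \<noteq> 0"
    using LIMSEQ_inverse_Suc by (auto simp: e_def[abs_def])
  have "(\<lambda>n. \<integral>x. (h (x + e n *\<^sub>R b) - h x) / e n \<partial>lborel) \<longlonglongrightarrow> (\<integral>x. h' x \<partial>lborel)"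
    using difference_quotient_integral_limit[OF K h h' der, of "\<lambda>_. 1" e] e by simp
  moreover have "(\<integral>x. (h (x + e n *\<^sub>R b) - h x) / e n \<partial>lborel) = 0" for n
    using integral_translation[OF int_h(2), of "e n *\<^sub>R b"] int_h(1)
      integrable_translation[OF int_h(1), of "e n *\<^sub>R b"]
    by simp
  ultimately show ?thesis
    by (simp add: LIMSEQ_const_iff del: integral_divide_zero)
qed

lemma has_derivative_directional:
  fixes f :: "'a::real_normed_vector \<Rightarrow> real"
  assumes "(f has_derivative f') (at x)"
  shows "((\<lambda>t. f (x + t *\<^sub>R b)) has_real_derivative f' b) (at 0)"
proof -
  have "((\<lambda>t::real. f (x + t *\<^sub>R b)) has_derivative (\<lambda>t. f' (t *\<^sub>R b))) (at 0)"
    by (rule has_derivative_compose[of "\<lambda>t::real. x + t *\<^sub>R b" "\<lambda>t. t *\<^sub>R b"])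
      (auto intro!: derivative_eq_intros assms)
  then show ?thesis
    using linear_cmul[OF has_derivative_linear[OF assms]]
    by (simp add: has_field_derivative_def mult_commute_abs)
qed

section \<open>Smearing a Lipschitz function\<close>

text \<open>For \<open>e > 0\<close> this is convolution with \<open>\<psi>\<close> rescaled to
  radius \<open>e\<close>; scaling the argument of \<open>f\<close> instead avoids the normalising
  power of \<open>e\<close>. The integral of \<open>\<psi>\<close> is left free because derivatives
  of the bump serve as kernels too.\<close>

definition smear :: "('a::euclidean_space \<Rightarrow> real) \<Rightarrow> ('a \<Rightarrow> real) \<Rightarrow> real \<Rightarrow> 'a \<Rightarrow> real" where
  "smear f \<psi> e x = (\<integral>y. f (x - e *\<^sub>R y) * \<psi> y \<partial>lborel)"

lemma bump_class_eq_0': "f \<in> bump_class \<Longrightarrow> z \<notin> cball 0 1 \<Longrightarrow> f z = 0"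
  using bump_class_eq_0[of f z] by simp

lemma bump_class_directional:
  "f \<in> bump_class \<Longrightarrow> ((\<lambda>t. f (x + t *\<^sub>R b)) has_real_derivative partial_deriv b f x) (at 0)"
  using has_derivative_directional[OF bump_class_has_derivative] .

lemma bump_class_mult_integrable:
  assumes "\<psi> \<in> bump_class" "continuous_on UNIV F"
  shows "integrable lborel (\<lambda>y. F y * \<psi> y)" "F \<in> borel_measurable borel" "\<psi> \<in> borel_measurable borel"
    "integrable lborel (\<lambda>y. F y * \<psi> (y + c))"
proof -
  have int: "integrable lborel (\<lambda>y. F y * \<psi> y)" if "continuous_on UNIV F" for F
    by (rule integrable_compact_support(1)[of "cball 0 1"])
      (auto intro!: continuous_on_mult continuous_on_subset[OF that] bump_class_continuous[OF assms(1)]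
        simp: bump_class_eq_0[OF assms(1)])
  show "integrable lborel (\<lambda>y. F y * \<psi> y)" by (rule int) fact
  show "F \<in> borel_measurable borel" "\<psi> \<in> borel_measurable borel"
    using assms bump_class_continuous borel_measurable_continuous_onI by blast+
  have "integrable lborel (\<lambda>y. F (y - c) * \<psi> y)"
    by (rule int) (auto intro!: continuous_intros continuous_on_compose2[OF assms(2)])
  from integrable_translation[OF this, of c]
  show "integrable lborel (\<lambda>y. F y * \<psi> (y + c))" by simp
qed

lemma bump_class_integrable: "\<psi> \<in> bump_class \<Longrightarrow> integrable lborel \<psi>"
  using bump_class_mult_integrable(1)[of \<psi> "\<lambda>_. 1"] by simp

lemma smear_integrable:
  assumes "\<psi> \<in> bump_class" "continuous_on UNIV f"
  shows "integrable lborel (\<lambda>y. f (x - e *\<^sub>R y) * \<psi> y)"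
  by (intro bump_class_mult_integrable assms continuous_on_compose2[OF assms(2)] continuous_intros) auto

text \<open>Substituting \<open>y + (t / e) *\<^sub>R b\<close> for \<open>y\<close> moves the
  increment from \<open>f\<close> to the kernel, so the derivative falls on \<open>\<psi>\<close>
  although \<open>f\<close> is merely continuous. The factor \<open>1 / e\<close> comes from the
  step \<open>t / e\<close>.\<close>

lemma smear_directional:
  fixes f :: "'a::euclidean_space \<Rightarrow> real"
  assumes \<psi>: "\<psi> \<in> bump_class" and f: "continuous_on UNIV f" and "e \<noteq> 0"
  shows "((\<lambda>t. smear f \<psi> e (x + t *\<^sub>R b)) has_real_derivative
    (1 / e) * smear f (partial_deriv b \<psi>) e x) (at 0)"
proof -
  define F where "F y = f (x - e *\<^sub>R y)" for y
  have F: "continuous_on UNIV F"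
    unfolding F_def by (intro continuous_on_compose2[OF f] continuous_intros) auto
  have shift: "smear f \<psi> e (x + t *\<^sub>R b) = (\<integral>y. F y * \<psi> (y + (t / e) *\<^sub>R b) \<partial>lborel)" for t
  proof -
    have [measurable]: "(\<lambda>y. f (x + t *\<^sub>R b - e *\<^sub>R y) * \<psi> y) \<in> borel_measurable borel"
      using smear_integrable[OF \<psi> f] by (metis borel_measurable_integrable measurable_lborel2)
    have "smear f \<psi> e (x + t *\<^sub>R b) =
      (\<integral>y. f (x + t *\<^sub>R b - e *\<^sub>R (y + (t / e) *\<^sub>R b)) * \<psi> (y + (t / e) *\<^sub>R b) \<partial>lborel)"
      unfolding smear_def by (rule integral_translation[symmetric]) measurable
    then show ?thesis
      using \<open>e \<noteq> 0\<close> by (simp add: F_def algebra_simps)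
  qed
  have "(\<lambda>n. (smear f \<psi> e (x + X n *\<^sub>R b) - smear f \<psi> e x) / X n) \<longlonglongrightarrow>
      (1 / e) * smear f (partial_deriv b \<psi>) e x"
    if X: "\<And>n. X n \<noteq> 0" "X \<longlonglongrightarrow> 0" for X :: "nat \<Rightarrow> real"
  proof -
    have "(\<lambda>n. X n / e) \<longlonglongrightarrow> 0" using tendsto_divide_zero[OF X(2)] .
    then have "(\<lambda>n. \<integral>y. F y * ((\<psi> (y + (X n / e) *\<^sub>R b) - \<psi> y) / (X n / e)) \<partial>lborel)
        \<longlonglongrightarrow> (\<integral>y. F y * partial_deriv b \<psi> y \<partial>lborel)"
      by (intro difference_quotient_integral_limit[of "cball 0 1"] F bump_class_eq_0' \<psi>
          bump_class_continuous bump_class_partial bump_class_directional)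
        (use X \<open>e \<noteq> 0\<close> in auto)
    then have "(\<lambda>n. (1 / e) * (\<integral>y. F y * ((\<psi> (y + (X n / e) *\<^sub>R b) - \<psi> y) / (X n / e)) \<partial>lborel))
        \<longlonglongrightarrow> (1 / e) * smear f (partial_deriv b \<psi>) e x"
      unfolding smear_def F_def by (intro tendsto_mult_left)
    moreover have "(1 / e) * (\<integral>y. F y * ((\<psi> (y + (X n / e) *\<^sub>R b) - \<psi> y) / (X n / e)) \<partial>lborel)
        = (smear f \<psi> e (x + X n *\<^sub>R b) - smear f \<psi> e x) / X n" for n
    proof -
      have eq: "(\<integral>y. F y * ((\<psi> (y + (X n / e) *\<^sub>R b) - \<psi> y) / (X n / e)) \<partial>lborel)
          = (\<integral>y. (F y * \<psi> (y + (X n / e) *\<^sub>R b) - F y * \<psi> y) * (e / X n) \<partial>lborel)"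
        by (simp add: algebra_simps diff_divide_distrib)
      have eq2: "\<dots> = ((\<integral>y. F y * \<psi> (y + (X n / e) *\<^sub>R b) \<partial>lborel) - (\<integral>y. F y * \<psi> y \<partial>lborel)) * (e / X n)"
        using bump_class_mult_integrable(1,4)[OF \<psi> F] by simp
      show ?thesis
        unfolding eq eq2 using shift[of "X n"] shift[of 0] \<open>e \<noteq> 0\<close> by simp
    qed
    ultimately show ?thesis by simp
  qed
  then show ?thesis
    unfolding has_field_derivative_iff tendsto_at_iff_sequentially by (auto simp: o_def)
qed

context
  fixes f :: "'a::euclidean_space \<Rightarrow> real"
  assumes lip: "\<And>x y. \<bar>f x - f y\<bar> \<le> norm (x - y)"
begin

lemma lipschitz_continuous: "continuous_on A f"
  unfolding continuous_on_iff by (metis dist_norm lip order_le_less_trans real_norm_def)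

lemma smear_lipschitz:
  assumes \<psi>: "\<psi> \<in> bump_class"
  shows "\<bar>smear f \<psi> e x - smear f \<psi> e x'\<bar> \<le> norm (x - x') * (\<integral>y. \<bar>\<psi> y\<bar> \<partial>lborel)"
proof -
  note int = smear_integrable[OF \<psi> lipschitz_continuous]
  have "\<bar>smear f \<psi> e x - smear f \<psi> e x'\<bar> = \<bar>\<integral>y. (f (x - e *\<^sub>R y) - f (x' - e *\<^sub>R y)) * \<psi> y \<partial>lborel\<bar>"
    using int by (simp add: smear_def left_diff_distrib)
  also have "\<dots> \<le> (\<integral>y. norm (x - x') * \<bar>\<psi> y\<bar> \<partial>lborel)"
  proof (rule integral_abs_bound[THEN order_trans], rule integral_mono)
    show "integrable lborel (\<lambda>y. \<bar>(f (x - e *\<^sub>R y) - f (x' - e *\<^sub>R y)) * \<psi> y\<bar>)"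
      using int by (simp add: left_diff_distrib)
    show "integrable lborel (\<lambda>y. norm (x - x') * \<bar>\<psi> y\<bar>)"
      using bump_class_integrable[OF \<psi>] by simp
    show "\<bar>(f (x - e *\<^sub>R y) - f (x' - e *\<^sub>R y)) * \<psi> y\<bar> \<le> norm (x - x') * \<bar>\<psi> y\<bar>" for y
      using lip[of "x - e *\<^sub>R y" "x' - e *\<^sub>R y"] by (simp add: abs_mult mult_right_mono)
  qed
  finally show ?thesis by simp
qed

text \<open>With partial derivatives of the bump as kernels, this also gives continuity of the
  derivatives of the mollification.\<close>

lemma smear_continuous:
  assumes "\<psi> \<in> bump_class" shows "continuous_on A (smear f \<psi> e)"
proof (rule lipschitz_on_continuous_on[of "\<integral>y. \<bar>\<psi> y\<bar> \<partial>lborel"], rule lipschitz_onI)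
  show "dist (smear f \<psi> e x) (smear f \<psi> e x') \<le> (\<integral>y. \<bar>\<psi> y\<bar> \<partial>lborel) * dist x x'" for x x'
    using smear_lipschitz[OF assms, of e x x'] by (simp add: dist_norm mult.commute)
qed simp

lemma smear_diff:
  assumes \<psi>: "\<psi> \<in> bump_class"
  shows "smear f \<psi> e x - f x * (\<integral>y. \<psi> y \<partial>lborel) = (\<integral>y. (f (x - e *\<^sub>R y) - f x) * \<psi> y \<partial>lborel)"
  using smear_integrable[OF \<psi> lipschitz_continuous] bump_class_integrable[OF \<psi>]
  by (simp add: smear_def left_diff_distrib)

text \<open>Off the unit ball the kernel vanishes; on it the argument of \<open>f\<close> moves by
  at most \<open>e\<close>.\<close>

lemma smear_diff_pointwise:
  assumes \<psi>: "\<psi> \<in> bump_class" and "e \<ge> 0"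
  shows "\<bar>(f (x - e *\<^sub>R y) - f x) * \<psi> y\<bar> \<le> e * \<bar>\<psi> y\<bar>"
proof (cases "norm y \<le> 1")
  case True
  then have "\<bar>f (x - e *\<^sub>R y) - f x\<bar> \<le> e"
    using lip[of "x - e *\<^sub>R y" x] \<open>e \<ge> 0\<close> mult_left_mono[of "norm y" 1 e] by simp
  then show ?thesis by (simp add: abs_mult mult_right_mono)
next
  case False
  then show ?thesis using bump_class_eq_0[OF \<psi>, of y] by simp
qed

lemma smear_close:
  assumes \<psi>: "\<psi> \<in> bump_class" and "e \<ge> 0"
  shows "\<bar>smear f \<psi> e x - f x * (\<integral>y. \<psi> y \<partial>lborel)\<bar> \<le> e * (\<integral>y. \<bar>\<psi> y\<bar> \<partial>lborel)"
proof -
  have "\<bar>\<integral>y. (f (x - e *\<^sub>R y) - f x) * \<psi> y \<partial>lborel\<bar> \<le> (\<integral>y. e * \<bar>\<psi> y\<bar> \<partial>lborel)"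
  proof (rule integral_abs_bound[THEN order_trans], rule integral_mono)
    show "integrable lborel (\<lambda>y. \<bar>(f (x - e *\<^sub>R y) - f x) * \<psi> y\<bar>)"
      using smear_integrable[OF \<psi> lipschitz_continuous] bump_class_integrable[OF \<psi>] by (simp add: left_diff_distrib)
  qed (use smear_diff_pointwise[OF assms] bump_class_integrable[OF \<psi>] in auto)
  then show ?thesis by (simp add: smear_diff[OF \<psi>])
qed

lemma integral_partial_bump:
  assumes "\<psi> \<in> bump_class" shows "(\<integral>y. partial_deriv b \<psi> y \<partial>lborel) = 0"
  by (rule integral_directional_deriv_eq_0[of "cball 0 1" \<psi> _ b])
    (use assms in \<open>auto intro: bump_class_continuous bump_class_partial bump_class_directional
      simp: bump_class_eq_0 bump_class_partial\<close>)

text \<open>A partial derivative of the kernel has integral 0, so \<open>f x\<close> may be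
  subtracted for free; the Lipschitz bound then supplies a factor \<open>e\<close> that cancels
  \<open>1 / e\<close>. The bound is uniform in \<open>e\<close>, as domination later
  requires.\<close>

lemma smear_partial_bound:
  assumes \<psi>: "\<psi> \<in> bump_class" and "e > 0"
  shows "\<bar>(1 / e) * smear f (partial_deriv b \<psi>) e x\<bar> \<le> (\<integral>y. \<bar>partial_deriv b \<psi> y\<bar> \<partial>lborel)"
  using smear_close[OF bump_class_partial[OF \<psi>], of e b x] \<open>e > 0\<close>
  by (simp add: integral_partial_bump[OF \<psi>] abs_mult field_simps)

text \<open>The same cancellation turns the integrand into a difference quotient of
  \<open>f\<close>, with limit \<open>- (D \<bullet> y)\<close>. Differentiability at the single
  point \<open>x\<close> is enough.\<close>

lemma smear_partial_tendsto:
  assumes \<psi>: "\<psi> \<in> bump_class" and D: "(f has_derivative (\<lambda>h. D \<bullet> h)) (at x)"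
    and e: "\<And>n. e n > 0" "e \<longlonglongrightarrow> 0"
  shows "(\<lambda>n. (1 / e n) * smear f (partial_deriv b \<psi>) (e n) x) \<longlonglongrightarrow> (D \<bullet> b) * (\<integral>y. \<psi> y \<partial>lborel)"
proof -
  define p where "p = partial_deriv b \<psi>"
  have p: "p \<in> bump_class" unfolding p_def by (rule bump_class_partial[OF \<psi>])
  note [measurable] = bump_class_mult_integrable(3)[OF p continuous_on_const[of UNIV 0]]
    borel_measurable_continuous_onI[OF lipschitz_continuous]
  have "(\<lambda>n. \<integral>y. ((f (x - e n *\<^sub>R y) - f x) / e n) * p y \<partial>lborel) \<longlonglongrightarrow> (\<integral>y. - (D \<bullet> y) * p y \<partial>lborel)"
  proof (rule integral_dominated_convergence[where w="\<lambda>y. \<bar>p y\<bar>"])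
    show "AE y in lborel. (\<lambda>n. ((f (x - e n *\<^sub>R y) - f x) / e n) * p y) \<longlonglongrightarrow> - (D \<bullet> y) * p y"
    proof (intro AE_I2 tendsto_mult_right)
      fix y
      have "e n \<noteq> 0" for n using e(1)[of n] by simp
      from directional_deriv_limit[OF has_derivative_directional[OF D, of "- y"] e(2) this]
      show "(\<lambda>n. (f (x - e n *\<^sub>R y) - f x) / e n) \<longlonglongrightarrow> - (D \<bullet> y)" by simp
    qed
    show "AE y in lborel. norm ((f (x - e n *\<^sub>R y) - f x) / e n * p y) \<le> \<bar>p y\<bar>" for n
      using smear_diff_pointwise[OF p, of "e n" x] e(1)[of n] by (auto simp: abs_mult field_simps)
  qed (use bump_class_integrable[OF p] in auto)
  moreover have "(\<integral>y. ((f (x - e n *\<^sub>R y) - f x) / e n) * p y \<partial>lborel) = (1 / e n) * smear f p (e n) x" for n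
    using smear_diff[OF p, of "e n" x] integral_partial_bump[OF \<psi>, of b] by (simp add: p_def)
  moreover have "(\<integral>y. - (D \<bullet> y) * p y \<partial>lborel) = (D \<bullet> b) * (\<integral>y. \<psi> y \<partial>lborel)"
  proof -
    \<comment> \<open>The integrand is the derivative of \<open>(D \<bullet> y) * \<psi> y\<close>
      along \<open>b\<close>, so its integral vanishes.\<close>
    have "(\<integral>y. (D \<bullet> b) * \<psi> y + (D \<bullet> y) * p y \<partial>lborel) = 0"
    proof (rule integral_directional_deriv_eq_0[of "cball 0 1" "\<lambda>y. (D \<bullet> y) * \<psi> y" _ b])
      show "((\<lambda>t. (D \<bullet> (y + t *\<^sub>R b)) * \<psi> (y + t *\<^sub>R b)) has_real_derivative (D \<bullet> b) * \<psi> y + (D \<bullet> y) * p y) (at 0)" for y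
      proof -
        have "((\<lambda>t. (D \<bullet> y + t * (D \<bullet> b)) * \<psi> (y + t *\<^sub>R b)) has_real_derivative (D \<bullet> b) * \<psi> y + (D \<bullet> y) * p y) (at 0)"
          unfolding p_def by (auto intro!: derivative_eq_intros bump_class_directional[OF \<psi>])
        then show ?thesis by (simp add: inner_add_right)
      qed
    qed (auto intro!: continuous_on_add continuous_on_mult continuous_on_inner continuous_on_const
        continuous_on_id bump_class_continuous[OF \<psi>] bump_class_continuous[OF p] simp: bump_class_eq_0 \<psi> p)
    moreover have "integrable lborel (\<lambda>y. (D \<bullet> y) * p y)"
      by (intro bump_class_mult_integrable p continuous_intros)
    ultimately show ?thesis
      using bump_class_integrable[OF \<psi>] by simp
  qed
  ultimately show ?thesis by (simp only: p_def)
qed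

end

text \<open>Up to a positive factor the sum is the Laplacian of the mollified distance at
  \<open>x\<close>. It equals, again up to a positive factor, the distributional pairing with the
  bump of radius \<open>e\<close> centred at \<open>x\<close>, which is admissible because the
  closed ball lies in \<open>\<Omega>\<close>.\<close>

lemma smear_laplacian_nonpos:
  fixes \<Omega> :: "'a::euclidean_space set"
  assumes super: "superharmonic_distr (dist_bd \<Omega>) \<Omega>" and "open \<Omega>" and e: "e > 0" and x: "cball x e \<subseteq> \<Omega>"
  shows "(\<Sum>b\<in>Basis. smear (dist_bd \<Omega>) (partial_deriv b (partial_deriv b bump)) e x) \<le> 0"
proof -
  define \<phi> where "\<phi> z = bump ((1 / e) *\<^sub>R (x - z))" for z :: 'a
  define L :: "'a \<Rightarrow> real" where "L y = (\<Sum>b\<in>Basis. partial_deriv b (partial_deriv b bump) y)" for y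
  have lip: "\<bar>dist_bd \<Omega> y - dist_bd \<Omega> z\<bar> \<le> norm (y - z)" for y z
    unfolding dist_bd_def by (metis dist_norm infdist_triangle_abs)
  note cont = lipschitz_continuous[OF lip]
  have pL: "partial_deriv b (partial_deriv b bump) \<in> bump_class" for b :: 'a
    by (intro bump_class_partial bump_in_class)
  have [measurable]: "L \<in> borel_measurable borel" "dist_bd \<Omega> \<in> borel_measurable borel"
    unfolding L_def using bump_class_mult_integrable(2,3)[OF pL cont] by auto
  have "{z. \<phi> z \<noteq> 0} \<subseteq> cball x e"
  proof
    fix z assume "z \<in> {z. \<phi> z \<noteq> 0}"
    then have "norm ((1 / e) *\<^sub>R (x - z)) < 1"
      using bump_pos_iff[of "(1 / e) *\<^sub>R (x - z)"] bump_nonneg[of "(1 / e) *\<^sub>R (x - z)"] by (auto simp: \<phi>_def)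
    then have "norm (x - z) / e < 1" using e by simp
    then show "z \<in> cball x e" using e by (simp add: dist_norm)
  qed
  then have cl: "closure {z. \<phi> z \<noteq> 0} \<subseteq> cball x e"
    by (rule closure_minimal) simp
  have "test_fun \<phi> \<Omega>"
    unfolding test_fun_def
  proof (intro conjI)
    show "smooth_on \<phi> UNIV"
      unfolding \<phi>_def using smooth_on_bump_reflect_scale(1)[OF bump_in_class] .
    show "compact (closure {z. \<phi> z \<noteq> 0})"
      using cl by (meson bounded_cball bounded_subset compact_eq_bounded_closed closed_closure)
  qed (use cl x in auto)
  moreover have "\<forall>z. 0 \<le> \<phi> z" by (simp add: \<phi>_def bump_nonneg)
  ultimately have "(\<integral>z\<in>\<Omega>. dist_bd \<Omega> z * laplacian \<phi> z \<partial>lebesgue) \<le> 0"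
    using super unfolding superharmonic_distr_def by blast
  moreover have lap: "laplacian \<phi> z = (1 / e\<^sup>2) * L ((1 / e) *\<^sub>R (x - z))" for z
  proof -
    have "partial_deriv b (partial_deriv b \<phi>) =
        (\<lambda>z. (1 / e\<^sup>2) * partial_deriv b (partial_deriv b bump) ((1 / e) *\<^sub>R (x - z)))" for b
    proof -
      have 1: "partial_deriv b \<phi> = (\<lambda>z. - (1 / e) * partial_deriv b bump ((1 / e) *\<^sub>R (x - z)))"
        using smooth_on_bump_reflect_scale(2)[OF bump_in_class, of b 1 e x] by (simp add: \<phi>_def[abs_def])
      show ?thesis
        unfolding 1 smooth_on_bump_reflect_scale(2)[OF bump_class_partial[OF bump_in_class]]
        by (simp add: power2_eq_square)
    qed
    then show ?thesis by (simp add: laplacian_def L_def sum_distrib_left)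
  qed
  moreover have "(\<integral>z\<in>\<Omega>. dist_bd \<Omega> z * laplacian \<phi> z \<partial>lebesgue)
      = (\<integral>z. dist_bd \<Omega> z * laplacian \<phi> z \<partial>lebesgue)"
    unfolding set_lebesgue_integral_def
    by (rule Bochner_Integration.integral_cong) (auto simp: indicator_def dist_bd_def)
  moreover have "\<dots> = (\<integral>z. dist_bd \<Omega> z * laplacian \<phi> z \<partial>lborel)"
    by (rule integral_completion) (simp add: lap)
  \<comment> \<open>Change of variables \<open>z = x - e *\<^sub>R y\<close>; the power of
    \<open>e\<close> is the Jacobian.\<close>
  moreover have "\<dots> = e ^ DIM('a) * (\<integral>y. dist_bd \<Omega> (x - e *\<^sub>R y) * ((1 / e\<^sup>2) * L y) \<partial>lborel)"
  proof -
    have "(\<integral>z. dist_bd \<Omega> z * laplacian \<phi> z \<partial>lborel) =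
      (\<integral>z. dist_bd \<Omega> z * laplacian \<phi> z
        \<partial>density (distr lborel borel (\<lambda>y. x + (- e) *\<^sub>R y)) (\<lambda>_. ennreal (\<bar>- e\<bar> ^ DIM('a))))"
      using lborel_affine[of "- e" x] e by simp
    also have "\<dots> = e ^ DIM('a) * (\<integral>y. dist_bd \<Omega> (x - e *\<^sub>R y) * ((1 / e\<^sup>2) * L y) \<partial>lborel)"
      using e by (subst integral_density) (auto simp: integral_distr lap)
    finally show ?thesis .
  qed
  ultimately have "e ^ DIM('a) * (\<integral>y. dist_bd \<Omega> (x - e *\<^sub>R y) * ((1 / e\<^sup>2) * L y) \<partial>lborel) \<le> 0"
    by linarith
  moreover have "0 < e ^ DIM('a)" using e by simp
  ultimately have "(\<integral>y. dist_bd \<Omega> (x - e *\<^sub>R y) * ((1 / e\<^sup>2) * L y) \<partial>lborel) \<le> 0"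
    by (metis mult_le_cancel_left_pos mult_zero_right)
  also have "(\<lambda>y. dist_bd \<Omega> (x - e *\<^sub>R y) * ((1 / e\<^sup>2) * L y)) = (\<lambda>y. (1 / e\<^sup>2) * (dist_bd \<Omega> (x - e *\<^sub>R y) * L y))"
    by (simp add: fun_eq_iff)
  finally have "(\<integral>y. dist_bd \<Omega> (x - e *\<^sub>R y) * L y \<partial>lborel) \<le> 0"
    using e by (simp add: divide_le_0_iff)
  then show ?thesis
    unfolding L_def smear_def sum_distrib_left
    by (subst (asm) Bochner_Integration.integral_sum) (use smear_integrable[OF pL cont] in auto)
qed

section \<open>Almost everywhere differentiability of the distance function\<close>

text \<open>Convexity is encoded as an affine support at every point, because this is what a nearest
  point supplies directly.\<close>

locale subdifferentiable =
  fixes k :: "'a::euclidean_space \<Rightarrow> real"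
  assumes subgradient: "\<exists>a. \<forall>h. k x + a \<bullet> h \<le> k (x + h)"
    and cont: "continuous_on UNIV k"
begin

text \<open>Division by \<open>e\<close>, not by its square: this is the gap between the forward and
  the backward difference quotient, so its vanishing in the limit expresses differentiability along
  \<open>b\<close>.\<close>

definition diff2 :: "'a \<Rightarrow> real \<Rightarrow> 'a \<Rightarrow> real" where
  "diff2 b e x = (k (x + e *\<^sub>R b) + k (x - e *\<^sub>R b) - 2 * k x) / e"

lemma diff2_nonneg: "e > 0 \<Longrightarrow> 0 \<le> diff2 b e x"
proof -
  assume "e > 0"
  obtain a where a: "\<And>h. k x + a \<bullet> h \<le> k (x + h)" using subgradient by blast
  have "2 * k x \<le> k (x + e *\<^sub>R b) + k (x - e *\<^sub>R b)"
    using a[of "e *\<^sub>R b"] a[of "- (e *\<^sub>R b)"] by simp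
  then show ?thesis using \<open>e > 0\<close> by (simp add: diff2_def)
qed

text \<open>The support at the intermediate point bounds \<open>k\<close> from below at both ends;
  in the convex combination the slopes cancel.\<close>

lemma segment_le:
  assumes "0 \<le> t" "t \<le> 1"
  shows "k (x + t *\<^sub>R h) \<le> (1 - t) * k x + t * k (x + h)"
proof -
  obtain a where a: "\<And>v. k (x + t *\<^sub>R h) + a \<bullet> v \<le> k (x + t *\<^sub>R h + v)"
    using subgradient[of "x + t *\<^sub>R h"] by blast
  have "k (x + t *\<^sub>R h) - t * (a \<bullet> h) \<le> k x" "k (x + t *\<^sub>R h) + (1 - t) * (a \<bullet> h) \<le> k (x + h)"
    using a[of "- t *\<^sub>R h"] a[of "(1 - t) *\<^sub>R h"] by (auto simp: algebra_simps)
  then have "(1 - t) * (k (x + t *\<^sub>R h) - t * (a \<bullet> h)) + t * (k (x + t *\<^sub>R h) + (1 - t) * (a \<bullet> h))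
      \<le> (1 - t) * k x + t * k (x + h)"
    using assms by (intro add_mono mult_left_mono) auto
  then show ?thesis by (simp add: algebra_simps)
qed

text \<open>The vector \<open>h\<close> is the average of its coordinate vectors stretched by the
  dimension, so this is Jensen's inequality. It reduces control in all directions to control along
  the axes.\<close>

lemma basis_jensen: "DIM('a) * k (x + h) \<le> (\<Sum>b\<in>Basis. k (x + (DIM('a) * (h \<bullet> b)) *\<^sub>R b))"
proof -
  obtain a where a: "\<And>v. k (x + h) + a \<bullet> v \<le> k (x + h + v)" using subgradient by blast
  have "(\<Sum>b\<in>Basis. k (x + h) + a \<bullet> ((DIM('a) * (h \<bullet> b)) *\<^sub>R b - h)) \<le> (\<Sum>b\<in>Basis. k (x + (DIM('a) * (h \<bullet> b)) *\<^sub>R b))"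
    using a[of "(DIM('a) * (h \<bullet> b)) *\<^sub>R b - h" for b] by (intro sum_mono) (auto simp: algebra_simps)
  moreover have "(\<Sum>b\<in>Basis. a \<bullet> ((DIM('a) * (h \<bullet> b)) *\<^sub>R b - h)) = 0"
    by (simp add: inner_diff_right sum_subtractf euclidean_inner[of a h] sum_distrib_left mult_ac)
  ultimately show ?thesis by (simp add: sum.distrib)
qed

lemma diff2_mono:
  assumes "0 < e'" "e' \<le> e"
  shows "diff2 b e' x \<le> diff2 b e x"
proof -
  have "e > 0" "0 \<le> e' / e" "e' / e \<le> 1" using assms by auto
  then have "k (x + e' *\<^sub>R b) \<le> (1 - e' / e) * k x + e' / e * k (x + e *\<^sub>R b)"
    "k (x - e' *\<^sub>R b) \<le> (1 - e' / e) * k x + e' / e * k (x - e *\<^sub>R b)"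
    using segment_le[of "e' / e" x "e *\<^sub>R b"] segment_le[of "e' / e" x "- (e *\<^sub>R b)"] by auto
  then have "k (x + e' *\<^sub>R b) + k (x - e' *\<^sub>R b) - 2 * k x \<le> e' * diff2 b e x"
    using \<open>e > 0\<close> unfolding diff2_def by (simp add: field_simps)
  then show ?thesis using assms(1) by (simp add: diff2_def[of b e'] field_simps)
qed

text \<open>The remainder after subtracting the support is convex, nonnegative and zero at the
  origin. Along an axis it is controlled by the second difference at one fixed step and shrinks at
  least linearly below that step; Jensen extends this to all directions.\<close>

lemma has_derivative_if_diff2_tendsto_0:
  assumes a: "\<And>h. k x + a \<bullet> h \<le> k (x + h)"
    and lim: "\<And>b. b \<in> Basis \<Longrightarrow> (\<lambda>n. diff2 b (1 / real (Suc n)) x) \<longlonglongrightarrow> 0"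
  shows "(k has_derivative (\<lambda>h. a \<bullet> h)) (at x)"
  unfolding has_derivative_at_alt
proof (intro conjI allI impI)
  fix \<epsilon> :: real assume "\<epsilon> > 0"
  let ?N = "real DIM('a)"
  have N: "?N > 0" by simp
  have "eventually (\<lambda>n. \<forall>b\<in>Basis. diff2 b (1 / real (Suc n)) x < \<epsilon> / ?N) sequentially"
    using \<open>\<epsilon> > 0\<close> by (intro eventually_ball_finite ballI order_tendstoD(2)[OF lim]) auto
  then obtain n where n: "\<And>b. b \<in> Basis \<Longrightarrow> diff2 b (1 / real (Suc n)) x < \<epsilon> / ?N"
    by (auto simp: eventually_sequentially)
  define e where "e = 1 / real (Suc n)"
  have e: "e > 0" by (simp add: e_def)
  define r where "r h = k (x + h) - k x - a \<bullet> h" for h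
  have r0: "r h \<ge> 0" for h using a[of h] by (simp add: r_def)
  have r1: "r (\<tau> *\<^sub>R b) \<le> \<bar>\<tau>\<bar> * (\<epsilon> / ?N)" if b: "b \<in> Basis" and \<tau>: "\<bar>\<tau>\<bar> \<le> e" for \<tau> b
  proof -
    \<comment> \<open>The point at full step \<open>e\<close> on the same side as
      \<open>\<tau>\<close>.\<close>
    define \<sigma> where "\<sigma> = sgn \<tau> * e"
    have \<sigma>: "\<tau> *\<^sub>R b = (\<bar>\<tau>\<bar> / e) *\<^sub>R (\<sigma> *\<^sub>R b)"
      using e by (simp add: \<sigma>_def abs_mult_sgn mult.commute)
    have "r (\<tau> *\<^sub>R b) \<le> (\<bar>\<tau>\<bar> / e) * r (\<sigma> *\<^sub>R b)"
      using segment_le[of "\<bar>\<tau>\<bar> / e" x "\<sigma> *\<^sub>R b"] \<tau> e unfolding \<sigma> r_def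
      by (simp add: algebra_simps)
    \<comment> \<open>Both remainders are nonnegative, so either is at most their sum, in which the
      slope \<open>a\<close> cancels and only the second difference remains.\<close>
    also have "r (\<sigma> *\<^sub>R b) \<le> r (e *\<^sub>R b) + r (- (e *\<^sub>R b))"
      using r0 by (cases \<tau> "0::real" rule: linorder_cases) (auto simp: \<sigma>_def r_def[of 0] add_nonneg_nonneg)
    also have "\<dots> = e * diff2 b e x"
      using e by (simp add: r_def diff2_def)
    also have "\<dots> \<le> e * (\<epsilon> / ?N)"
      using n[OF b] e unfolding e_def[symmetric] by (intro mult_left_mono) auto
    finally show ?thesis using e by (simp add: mult_left_mono divide_right_mono)
  qed
  show "\<exists>d>0. \<forall>y. norm (y - x) < d \<longrightarrow> norm (k y - k x - a \<bullet> (y - x)) \<le> \<epsilon> * norm (y - x)"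
  \<comment> \<open>Jensen stretches coordinates by the dimension, and the stretched ones must stay
    below \<open>e\<close>.\<close>
  proof (intro exI[of _ "e / ?N"] conjI allI impI)
    show "e / ?N > 0" using e by simp
    fix y assume y: "norm (y - x) < e / ?N"
    define h where "h = y - x"
    have "r ((?N * (h \<bullet> b)) *\<^sub>R b) \<le> \<epsilon> * norm h" if "b \<in> Basis" for b
    proof -
      have hb: "\<bar>?N * (h \<bullet> b)\<bar> \<le> ?N * norm h"
        using Basis_le_norm[OF that, of h] by (simp add: abs_mult)
      also have "\<dots> \<le> e" using y N by (simp add: h_def field_simps)
      finally have "r ((?N * (h \<bullet> b)) *\<^sub>R b) \<le> \<bar>?N * (h \<bullet> b)\<bar> * (\<epsilon> / ?N)" by (rule r1[OF that])
      also have "\<dots> \<le> (?N * norm h) * (\<epsilon> / ?N)"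
        using hb \<open>\<epsilon> > 0\<close> by (intro mult_right_mono) auto
      finally show ?thesis by (simp add: mult.commute)
    qed
    then have "(\<Sum>b\<in>Basis. r ((?N * (h \<bullet> b)) *\<^sub>R b)) \<le> ?N * (\<epsilon> * norm h)"
      by (rule sum_bounded_above)
    moreover have "(\<Sum>b\<in>Basis. r ((?N * (h \<bullet> b)) *\<^sub>R b)) =
        (\<Sum>b\<in>Basis. k (x + (?N * (h \<bullet> b)) *\<^sub>R b)) - ?N * k x - ?N * (a \<bullet> h)"
      by (simp add: r_def sum_subtractf euclidean_inner[of a h] sum_distrib_left mult_ac)
    ultimately have "?N * r h \<le> ?N * (\<epsilon> * norm h)"
      using basis_jensen[of x h] by (simp add: r_def algebra_simps)
    then have "r h \<le> \<epsilon> * norm h" using N by (simp only: mult_le_cancel_left_pos)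
    then show "norm (k y - k x - a \<bullet> (y - x)) \<le> \<epsilon> * norm (y - x)"
      using r0[of h] by (simp add: r_def h_def)
  qed
qed (rule bounded_linear_inner_right)

text \<open>Tested against a bump function, the second difference falls on the bump function and tends to 0;
  since it is monotone in the step size, it tends to 0 almost everywhere.\<close>

lemma AE_diff2_tendsto_0_ball:
  fixes b :: 'a
  assumes R: "R > 0"
  shows "AE x in lborel. norm x < R \<longrightarrow> (\<lambda>n. diff2 b (1 / real (Suc n)) x) \<longlonglongrightarrow> 0"
proof -
  \<comment> \<open>A bump positive exactly on the open ball of radius \<open>R\<close>.\<close>
  define \<eta> where "\<eta> x = bump ((1 / R) *\<^sub>R x)" for x :: 'a
  define \<eta>' where "\<eta>' x = partial_deriv ((1 / R) *\<^sub>R b) bump ((1 / R) *\<^sub>R x)" for x :: 'a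
  define e where "e n = 1 / real (Suc n)" for n
  have e: "e \<longlonglongrightarrow> 0" "\<And>n. e n > 0" "\<And>n. e n \<noteq> 0" "\<And>m n. m \<le> n \<Longrightarrow> e n \<le> e m"
    using LIMSEQ_inverse_Suc by (auto simp: e_def[abs_def] frac_le)
  have der: "((\<lambda>t. \<eta> (x + t *\<^sub>R b)) has_real_derivative \<eta>' x) (at 0)" for x
    using bump_class_directional[OF bump_in_class, of "(1 / R) *\<^sub>R x" "(1 / R) *\<^sub>R b"]
    by (simp add: \<eta>_def \<eta>'_def scaleR_add_right mult.commute)
  have out: "norm ((1 / R) *\<^sub>R x) \<ge> 1" if "x \<notin> cball 0 R" for x :: 'a
    using that R by simp
  have \<eta>_cont: "continuous_on A \<eta>" "continuous_on A \<eta>'" for A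
  proof -
    have "continuous_on A (\<lambda>x. f ((1 / R) *\<^sub>R x))" if "f \<in> bump_class" for f :: "'a \<Rightarrow> real"
      by (rule continuous_on_compose2[OF bump_class_continuous[OF that, of UNIV]])
        (auto intro!: continuous_intros)
    then show "continuous_on A \<eta>" "continuous_on A \<eta>'"
      unfolding \<eta>_def \<eta>'_def by (blast intro: bump_in_class bump_class_partial)+
  qed
  have \<eta>_out: "\<eta> x = 0" "\<eta>' x = 0" if "x \<notin> cball 0 R" for x
    unfolding \<eta>_def \<eta>'_def
    by (intro bump_class_eq_0 bump_class_partial bump_in_class out[OF that])+
  have int: "integrable lborel (\<lambda>x. \<eta> x * F x)" if "continuous_on UNIV F" for F
    by (rule integrable_compact_support(1)[of "cball 0 R"])
      (auto intro!: continuous_on_mult \<eta>_cont continuous_on_subset[OF that] simp: \<eta>_out)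
  have int': "integrable lborel (\<lambda>x. \<eta> (x + c) * k x)" for c
  proof -
    have "continuous_on UNIV (\<lambda>x. k (x - c))"
      by (intro continuous_on_compose2[OF cont] continuous_intros) auto
    from integrable_translation[OF int[OF this], of c] show ?thesis by simp
  qed
  have k_shift: "continuous_on UNIV (\<lambda>x. k (x + c))" for c
    by (intro continuous_on_compose2[OF cont] continuous_intros) auto
  have shift: "(\<integral>x. \<eta> x * k (x + c) \<partial>lborel) = (\<integral>x. \<eta> (x - c) * k x \<partial>lborel)" for c
  proof -
    have "(\<lambda>x. \<eta> (x - c) * k x) \<in> borel_measurable borel"
      using int'[of "- c"] by (auto dest: borel_measurable_integrable)
    from integral_translation[OF this, of c] show ?thesis by simp
  qed
  define q where "q n x = diff2 b (e n) x" for n x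
  have q_cont: "continuous_on UNIV (q n)" for n
    unfolding q_def diff2_def
    by (intro continuous_intros continuous_on_compose2[OF cont]) (auto simp: e(3))
  note int_q = int[OF q_cont]
  \<comment> \<open>Translation moves both shifts from \<open>k\<close> to \<open>\<eta>\<close>.
    The second difference becomes a quotient with step \<open>e n\<close> minus one with step
    \<open>- e n\<close>; both converge to the same integral against \<open>\<eta>'\<close>, so no
    derivative of \<open>k\<close> is needed.\<close>
  have q_int: "(\<integral>x. \<eta> x * q n x \<partial>lborel) =
      (\<integral>x. k x * ((\<eta> (x + e n *\<^sub>R b) - \<eta> x) / e n) \<partial>lborel)
      - (\<integral>x. k x * ((\<eta> (x + (- e n) *\<^sub>R b) - \<eta> x) / (- e n)) \<partial>lborel)" for n
  proof -
    let ?I = "\<integral>x. \<eta> x * k x \<partial>lborel"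
    let ?P = "\<integral>x. \<eta> (x + e n *\<^sub>R b) * k x \<partial>lborel"
    let ?M = "\<integral>x. \<eta> (x - e n *\<^sub>R b) * k x \<partial>lborel"
    have "(\<integral>x. \<eta> x * q n x \<partial>lborel) =
      (\<integral>x. (\<eta> x * k (x + e n *\<^sub>R b) + \<eta> x * k (x - e n *\<^sub>R b) - 2 * (\<eta> x * k x)) / e n \<partial>lborel)"
      by (simp add: q_def diff2_def algebra_simps)
    also have "\<dots> = (?M + ?P - 2 * ?I) / e n"
      using int[OF k_shift[of "e n *\<^sub>R b"]] int[OF k_shift[of "- (e n *\<^sub>R b)"]] int[OF cont]
        shift[of "e n *\<^sub>R b"] shift[of "- (e n *\<^sub>R b)"] by simp
    finally have 1: "(\<integral>x. \<eta> x * q n x \<partial>lborel) = (?M + ?P - 2 * ?I) / e n" .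
    have "(\<integral>x. k x * ((\<eta> (x + e n *\<^sub>R b) - \<eta> x) / e n) \<partial>lborel) =
      (\<integral>x. (\<eta> (x + e n *\<^sub>R b) * k x - \<eta> x * k x) / e n \<partial>lborel)"
      by (simp add: algebra_simps)
    also have "\<dots> = (?P - ?I) / e n"
      using int'[of "e n *\<^sub>R b"] int[OF cont] by simp
    finally have 2: "(\<integral>x. k x * ((\<eta> (x + e n *\<^sub>R b) - \<eta> x) / e n) \<partial>lborel) = (?P - ?I) / e n" .
    have "(\<integral>x. k x * ((\<eta> (x + (- e n) *\<^sub>R b) - \<eta> x) / (- e n)) \<partial>lborel) =
      (\<integral>x. (\<eta> (x - e n *\<^sub>R b) * k x - \<eta> x * k x) / (- e n) \<partial>lborel)"
      by (simp add: algebra_simps)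
    also have "\<dots> = (?M - ?I) / (- e n)"
      using int'[of "- (e n *\<^sub>R b)"] int[OF cont] by (subst integral_divide_zero) simp
    finally show ?thesis unfolding 1 2 using e(3)[of n] by (simp add: field_simps)
  qed
  have "(\<lambda>n. \<integral>x. \<eta> x * q n x \<partial>lborel) \<longlonglongrightarrow> (\<integral>x. k x * \<eta>' x \<partial>lborel) - (\<integral>x. k x * \<eta>' x \<partial>lborel)"
    unfolding q_int
  proof (intro tendsto_diff)
    have lim: "(\<lambda>n. \<integral>x. k x * ((\<eta> (x + f n *\<^sub>R b) - \<eta> x) / f n) \<partial>lborel) \<longlonglongrightarrow> (\<integral>x. k x * \<eta>' x \<partial>lborel)"
      if "f \<longlonglongrightarrow> 0" "\<And>n. f n \<noteq> 0" for f
      by (rule difference_quotient_integral_limit[where K="cball 0 R"])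
        (rule compact_cball \<eta>_cont \<eta>_out der cont that | assumption)+
    show "(\<lambda>n. \<integral>x. k x * ((\<eta> (x + e n *\<^sub>R b) - \<eta> x) / e n) \<partial>lborel) \<longlonglongrightarrow> (\<integral>x. k x * \<eta>' x \<partial>lborel)"
      by (rule lim[OF e(1,3)])
    have "(\<lambda>n. - e n) \<longlonglongrightarrow> 0" using tendsto_minus[OF e(1)] by simp
    moreover have "- e n \<noteq> 0" for n using e(3)[of n] by simp
    ultimately show "(\<lambda>n. \<integral>x. k x * ((\<eta> (x + (- e n) *\<^sub>R b) - \<eta> x) / (- e n)) \<partial>lborel) \<longlonglongrightarrow> (\<integral>x. k x * \<eta>' x \<partial>lborel)"
      by (rule lim)
  qed
  then have q_lim: "(\<lambda>n. \<integral>x. \<eta> x * q n x \<partial>lborel) \<longlonglongrightarrow> 0" by simp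
  have q0: "0 \<le> q n x" for n x unfolding q_def by (rule diff2_nonneg[OF e(2)])
  have dec: "decseq (\<lambda>n. q n x)" for x
    unfolding decseq_def q_def using diff2_mono[OF e(2)] e(4) by blast
  \<comment> \<open>The pointwise limit exists because the second differences decrease and are
    nonnegative. It lies below every \<open>q n\<close>, so its weighted integral is at most
    0.\<close>
  define L where "L x = lim (\<lambda>n. q n x)" for x
  have conv: "(\<lambda>n. q n x) \<longlonglongrightarrow> L x" for x
  proof -
    obtain l where "(\<lambda>n. q n x) \<longlonglongrightarrow> l"
      using decseq_convergent[OF dec[of x], of 0] q0 by blast
    then show ?thesis unfolding L_def by (simp add: limI)
  qed
  have L: "0 \<le> L x" "L x \<le> q n x" for x n
    using LIMSEQ_le_const[OF conv] q0 decseq_ge[OF dec conv] by blast+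
  have [measurable]: "q n \<in> borel_measurable borel" for n
    using q_cont borel_measurable_continuous_onI by blast
  have [measurable]: "L \<in> borel_measurable borel"
    unfolding L_def[abs_def] by measurable
  have [measurable]: "\<eta> \<in> borel_measurable borel"
    using \<eta>_cont borel_measurable_continuous_onI by blast
  have \<eta>0: "\<eta> x \<ge> 0" for x by (simp add: \<eta>_def bump_nonneg)
  have int_L: "integrable lborel (\<lambda>x. \<eta> x * L x)"
    by (rule Bochner_Integration.integrable_bound[OF int_q[of 0]])
      (auto simp: abs_mult \<eta>0 L q0 intro!: mult_left_mono)
  have "(\<integral>x. \<eta> x * L x \<partial>lborel) \<le> (\<integral>x. \<eta> x * q n x \<partial>lborel)" for n
    by (intro integral_mono int_L int_q mult_left_mono L \<eta>0)
  then have "(\<integral>x. \<eta> x * L x \<partial>lborel) \<le> 0"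
    using LIMSEQ_le_const[OF q_lim] by blast
  then have "(\<integral>x. \<eta> x * L x \<partial>lborel) = 0"
    by (intro antisym integral_nonneg_AE) (auto simp: \<eta>0 L)
  then have "AE x in lborel. \<eta> x * L x = 0"
    by (subst (asm) integral_nonneg_eq_0_iff_AE[OF int_L]) (auto simp: \<eta>0 L)
  then show ?thesis
  proof eventually_elim
    case (elim x)
    have "\<eta> x > 0" if "norm x < R" using that R by (simp add: \<eta>_def bump_pos_iff)
    then show ?case using elim conv[of x] by (auto simp: q_def e_def)
  qed
qed

lemma AE_diff2_tendsto_0: "AE x in lborel. \<forall>b\<in>Basis. (\<lambda>n. diff2 b (1 / real (Suc n)) x) \<longlonglongrightarrow> 0"
proof -
  have "AE x in lborel. (\<lambda>n. diff2 b (1 / real (Suc n)) x) \<longlonglongrightarrow> 0" for b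
  proof -
    have "AE x in lborel. \<forall>j::nat. norm x < real (Suc j) \<longrightarrow> (\<lambda>n. diff2 b (1 / real (Suc n)) x) \<longlonglongrightarrow> 0"
      unfolding AE_all_countable by (intro allI AE_diff2_tendsto_0_ball) simp
    then show ?thesis
    proof eventually_elim
      case (elim x)
      obtain j where "norm x < real j" using reals_Archimedean2 by blast
      then have "norm x < real (Suc j)" by simp
      then show ?case using elim by blast
    qed
  qed
  then show ?thesis by (intro AE_finite_allI) auto
qed

end

text \<open>The function \<open>x \<bullet> x - (infdist x S)\<^sup>2\<close> is the supremum of the affine functions
  \<open>2 * (x \<bullet> p) - p \<bullet> p\<close> over \<open>p \<in> S\<close>, hence convex, and a nearest point \<open>p\<close> gives the subgradient \<open>2 p\<close>.\<close>

lemma infdist_subgradient: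
  fixes S :: "'a::euclidean_space set"
  assumes "p \<in> S" "infdist x S = dist x p"
  shows "x \<bullet> x - (infdist x S)\<^sup>2 + (2 *\<^sub>R p) \<bullet> h \<le> (x + h) \<bullet> (x + h) - (infdist (x + h) S)\<^sup>2"
proof -
  have "(infdist (x + h) S)\<^sup>2 \<le> (dist (x + h) p)\<^sup>2"
    using infdist_le[OF assms(1)] infdist_nonneg by (intro power_mono)
  then show ?thesis
    unfolding assms(2) dist_norm power2_norm_eq_inner
    by (simp add: algebra_simps inner_commute)
qed

text \<open>Where \<open>k\<close> is differentiable its gradient is \<open>2 *\<^sub>R p\<close>
  for a nearest point \<open>p\<close>. Off \<open>S\<close> the distance is positive, so the square
  root in \<open>sqrt (x \<bullet> x - k x)\<close> can be differentiated, giving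
  \<open>(x - p) / d\<close>, of norm 1 because \<open>d = norm (x - p)\<close>.\<close>

lemma AE_infdist_has_unit_derivative:
  fixes S :: "'a::euclidean_space set"
  assumes "closed S" "S \<noteq> {}"
  shows "AE x in lborel. x \<notin> S \<longrightarrow>
    (\<exists>D. norm D = 1 \<and> ((\<lambda>x. infdist x S) has_derivative (\<lambda>h. D \<bullet> h)) (at x))"
proof -
  define k where "k x = x \<bullet> x - (infdist x S)\<^sup>2" for x
  have sub: "\<exists>p\<in>S. infdist x S = dist x p \<and> (\<forall>h. k x + (2 *\<^sub>R p) \<bullet> h \<le> k (x + h))" for x
    using infdist_attains_inf[OF assms, of x] infdist_subgradient unfolding k_def by metis
  interpret subdifferentiable k
  proof
    show "continuous_on UNIV k" unfolding k_def by (intro continuous_intros)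
  qed (use sub in blast)
  from AE_diff2_tendsto_0 show ?thesis
  proof eventually_elim
    case (elim x)
    show ?case
    proof
      assume "x \<notin> S"
      obtain p where p: "p \<in> S" "infdist x S = dist x p" "\<And>h. k x + (2 *\<^sub>R p) \<bullet> h \<le> k (x + h)"
        using sub by blast
      define d where "d = infdist x S"
      have d: "d > 0" "d = norm (x - p)"
        using p \<open>x \<notin> S\<close> by (auto simp: d_def dist_norm)
      have k: "(k has_derivative (\<lambda>h. (2 *\<^sub>R p) \<bullet> h)) (at x)"
        using elim by (intro has_derivative_if_diff2_tendsto_0 p) auto
      have 1: "((\<lambda>y. y \<bullet> y - k y) has_derivative (\<lambda>h. 2 * ((x - p) \<bullet> h))) (at x)"
        by (auto intro!: derivative_eq_intros k simp: algebra_simps inner_commute)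
      have "x \<bullet> x - k x = d\<^sup>2" by (simp add: k_def d_def)
      then have 2: "(sqrt has_derivative (*) (inverse (sqrt (d\<^sup>2)) / 2)) (at (x \<bullet> x - k x))"
        using DERIV_real_sqrt[of "x \<bullet> x - k x"] d(1) by (simp add: has_field_derivative_def)
      have 3: "((\<lambda>y. sqrt (y \<bullet> y - k y)) has_derivative (\<lambda>h. inverse (sqrt (d\<^sup>2)) / 2 * (2 * ((x - p) \<bullet> h)))) (at x)"
        by (rule has_derivative_compose[OF 1 2])
      have 4: "(\<lambda>y. sqrt (y \<bullet> y - k y)) = (\<lambda>y. infdist y S)"
        by (simp add: k_def infdist_nonneg)
      have 5: "(\<lambda>h. inverse (sqrt (d\<^sup>2)) / 2 * (2 * ((x - p) \<bullet> h))) = (\<lambda>h. ((1 / d) *\<^sub>R (x - p)) \<bullet> h)"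
        using d(1) unfolding inner_scaleR_left real_sqrt_abs abs_of_pos[OF d(1)]
        by (intro ext) (simp only: inverse_eq_divide, simp)
      have "norm ((1 / d) *\<^sub>R (x - p)) = 1"
        unfolding norm_scaleR d(2)[symmetric] using d(1) by simp
      moreover have "((\<lambda>y. infdist y S) has_derivative (\<lambda>h. ((1 / d) *\<^sub>R (x - p)) \<bullet> h)) (at x)"
        using 3 unfolding 4 5 .
      ultimately show "\<exists>D. norm D = 1 \<and> ((\<lambda>x. infdist x S) has_derivative (\<lambda>h. D \<bullet> h)) (at x)"
        by (intro exI[of _ "(1 / d) *\<^sub>R (x - p)"] conjI)
    qed
  qed
qed

section \<open>The weighted gradient inequality\<close>

lemma bump_integral_pos: "0 < (\<integral>y. bump (y::'a::euclidean_space) \<partial>lborel)"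
proof -
  have "(\<integral>y. bump (y::'a) \<partial>lborel) \<noteq> 0"
  proof
    assume "(\<integral>y. bump (y::'a) \<partial>lborel) = 0"
    then have "AE y in lborel. bump (y::'a) = 0"
      using integral_nonneg_eq_0_iff_AE[OF bump_class_integrable[OF bump_in_class]] bump_nonneg by auto
    then have "AE y in lborel. y \<notin> ball (0::'a) 1"
      by eventually_elim (use bump_pos_iff in force)
    then have "ball (0::'a) 1 \<in> null_sets lborel"
      by (subst AE_iff_null_sets) auto
    then show False
      using content_ball_pos[of 1 "0::'a"] by (simp add: measure_def null_setsD1)
  qed
  moreover have "(\<integral>y. bump (y::'a) \<partial>lborel) \<ge> 0"
    by (intro integral_nonneg_AE) (simp add: bump_nonneg)
  ultimately show ?thesis by linarith
qed

text \<open>Here \<open>v\<close> stands for a differentiable nonnegative substitute for the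
  absolute value of \<open>u\<close>, and \<open>G\<close> for its gradient. Integrating over
  \<open>K\<close> keeps the negative powers of the distance bounded.\<close>

lemma weighted_gradient_inequality:
  fixes \<Omega> :: "'a::euclidean_space set" and v :: "'a \<Rightarrow> real" and G :: "'a \<Rightarrow> 'a"
  assumes "open \<Omega>" and "\<Omega> \<noteq> UNIV"
    and super: "superharmonic_distr (dist_bd \<Omega>) \<Omega>"
    and R: "\<And>x. dist_bd \<Omega> x \<le> R" and s: "s > 1"
    and K: "compact K" "K \<subseteq> \<Omega>" and v0: "\<And>x. 0 \<le> v x"
    and out: "\<And>x. x \<notin> K \<Longrightarrow> v x = 0" "\<And>x. x \<notin> K \<Longrightarrow> G x = 0"
    and G: "\<And>x. (v has_derivative (\<lambda>h. G x \<bullet> h)) (at x)" "continuous_on K G"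
  shows "0 \<le> (LBINT x:K. norm (G x) * (dist_bd \<Omega> x powr (1 - s) - R powr (1 - s))
      - (s - 1) * (v x * dist_bd \<Omega> x powr - s))"
proof (cases "K = {}")
  case True
  then show ?thesis by (simp add: set_lebesgue_integral_def)
next
  case False
  define d where "d = dist_bd \<Omega>"
  have d_infdist: "d = (\<lambda>x. infdist x (- \<Omega>))" by (simp add: d_def dist_bd_def fun_eq_iff)
  have S: "closed (- \<Omega>)" "- \<Omega> \<noteq> {}" using assms(1,2) by auto
  have lip: "\<bar>d y - d z\<bar> \<le> norm (y - z)" for y z
    unfolding d_infdist by (metis dist_norm infdist_triangle_abs)
  note d_cont = lipschitz_continuous[OF lip]
  have d_pos: "d x > 0" if "x \<in> K" for x
    unfolding d_infdist using infdist_pos_not_in_closed[OF S] that K by auto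
  obtain x0 where x0: "x0 \<in> K" "\<And>x. x \<in> K \<Longrightarrow> d x0 \<le> d x"
    using continuous_attains_inf[OF K(1) False d_cont] by auto
  \<comment> \<open>Half the minimal distance over \<open>K\<close>: mollifying at radius at most
    \<open>\<delta>\<close> stays inside \<open>\<Omega>\<close>, so superharmonicity applies, and
    lowers the distance by at most \<open>\<delta>\<close>, so it stays above
    \<open>\<delta>\<close> on \<open>K\<close>.\<close>
  define \<delta> where "\<delta> = d x0 / 2"
  have \<delta>: "\<delta> > 0" "\<And>x. x \<in> K \<Longrightarrow> 2 * \<delta> \<le> d x" using d_pos x0 by (auto simp: \<delta>_def)
  define e where "e n = \<delta> * (1 / real (Suc n))" for n
  have e: "e \<longlonglongrightarrow> 0" "\<And>n. e n > 0" "\<And>n. e n \<le> \<delta>"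
    using tendsto_mult_right_zero[OF LIMSEQ_inverse_Suc, of \<delta>] \<delta>(1)
    by (auto simp: e_def[abs_def] field_simps)
  define m where "m = (\<integral>y. bump (y::'a) \<partial>lborel)"
  have m: "m > 0" unfolding m_def by (rule bump_integral_pos)
  have p1: "partial_deriv b bump \<in> bump_class" and p2: "partial_deriv b (partial_deriv b bump) \<in> bump_class"
    for b :: 'a
    by (intro bump_class_partial bump_in_class)+

  \<comment> \<open>Division by the mass \<open>m\<close> normalises the kernel: \<open>E n\<close>
    is the mollified distance, \<open>P n b\<close> and \<open>Q n b\<close> are its first and
    second derivatives along \<open>b\<close>.\<close>
  define E where "E n x = smear d bump (e n) x / m" for n x
  define P where "P n b x = (1 / e n) * smear d (partial_deriv b bump) (e n) x / m" for n b x
  define Q where "Q n b x = (1 / e n) * ((1 / e n) * smear d (partial_deriv b (partial_deriv b bump)) (e n) x) / m" for n b x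
  have E_der: "((\<lambda>t. E n (x + t *\<^sub>R b)) has_real_derivative P n b x) (at 0)" for n b x
    unfolding E_def P_def
    by (intro DERIV_cdivide smear_directional bump_in_class d_cont) (use e(2)[of n] in simp)
  have P_der: "((\<lambda>t. P n b (x + t *\<^sub>R b)) has_real_derivative Q n b x) (at 0)" for n b x
    unfolding P_def Q_def
    by (intro DERIV_cdivide DERIV_cmult smear_directional p1 d_cont) (use e(2)[of n] in simp)
  have E_cont: "continuous_on A (E n)" and P_cont: "continuous_on A (P n b)"
    and Q_cont: "continuous_on A (Q n b)" for A n b
    unfolding E_def[abs_def] P_def[abs_def] Q_def[abs_def]
    by (intro continuous_intros smear_continuous[OF lip] bump_in_class p1 p2; use m in simp)+
  have E_close: "\<bar>E n x - d x\<bar> \<le> e n" for n x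
  proof -
    have "\<bar>smear d bump (e n) x - d x * m\<bar> \<le> e n * m"
      using smear_close[OF lip bump_in_class, of "e n" x] e(2)[of n] by (simp add: m_def bump_nonneg)
    then have "\<bar>smear d bump (e n) x - d x * m\<bar> / m \<le> e n" using m by (simp add: field_simps)
    moreover have "E n x - d x = (smear d bump (e n) x - d x * m) / m"
      using m by (simp add: E_def field_simps)
    ultimately show ?thesis using m by (simp add: abs_divide)
  qed
  have E_lower: "\<delta> \<le> E n x" if "x \<in> K" for n x
    using E_close[of n x] \<delta>(2)[OF that] e(3)[of n] by linarith
  have E_pos: "E n x > 0" if "x \<in> K" for n x
    using E_lower[OF that, of n] \<delta>(1) by linarith
  \<comment> \<open>Averaging preserves the upper bound; this keeps \<open>g (E n x)\<close>
    nonnegative for the mollified distance as well.\<close>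
  have E_upper: "E n x \<le> R" for n x
  proof -
    have "smear d bump (e n) x \<le> (\<integral>y. R * bump (y::'a) \<partial>lborel)"
      unfolding smear_def
    proof (rule integral_mono)
      show "integrable lborel (\<lambda>y. d (x - e n *\<^sub>R y) * bump y)"
        by (rule smear_integrable[OF bump_in_class d_cont])
      show "integrable lborel (\<lambda>y::'a. R * bump y)"
        by (intro integrable_mult_right bump_class_integrable bump_in_class)
      show "d (x - e n *\<^sub>R y) * bump y \<le> R * bump y" for y
        using R bump_nonneg by (intro mult_right_mono) (simp_all add: d_def)
    qed
    then show ?thesis using m by (simp add: E_def m_def field_simps)
  qed
  have R0: "R > 0" using E_pos[OF x0(1), of 0] E_upper[of 0 x0] by linarith
  have Q_sum: "(\<Sum>b\<in>Basis. Q n b x) \<le> 0" if "x \<in> K" for n x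
  proof -
    have "cball x (e n) \<subseteq> \<Omega>"
    proof
      fix z assume z: "z \<in> cball x (e n)"
      show "z \<in> \<Omega>"
      proof (rule ccontr)
        assume "z \<notin> \<Omega>"
        then have "d x \<le> dist x z" unfolding d_infdist by (intro infdist_le) auto
        then show False using z e(3)[of n] \<delta>(1) \<delta>(2)[OF that] by auto
      qed
    qed
    from smear_laplacian_nonpos[OF super assms(1) e(2) this]
    have "(\<Sum>b\<in>Basis. smear d (partial_deriv b (partial_deriv b bump)) (e n) x) \<le> 0" by (simp add: d_def)
    then have "(1 / e n) * ((1 / e n) * (\<Sum>b\<in>Basis. smear d (partial_deriv b (partial_deriv b bump)) (e n) x)) / m \<le> 0"
      using e(2)[of n] m by (intro divide_nonpos_pos mult_nonneg_nonpos) auto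
    then show ?thesis by (simp add: Q_def sum_distrib_left sum_divide_distrib)
  qed

  define g where "g t = t powr (1 - s) - R powr (1 - s)" for t
  have g_der: "(g has_real_derivative (1 - s) * t powr - s) (at t)" if "t > 0" for t
    unfolding g_def using that by (auto intro!: derivative_eq_intros)
  have g0: "0 \<le> g t" if "0 < t" "t \<le> R" for t
    unfolding g_def using that s powr_mono2'[of "1 - s" t R] by simp
  have g_upper: "g t \<le> \<delta> powr (1 - s)" if "\<delta> \<le> t" for t
  proof -
    have "t powr (1 - s) \<le> \<delta> powr (1 - s)" using that s \<delta>(1) by (intro powr_mono2') auto
    then show ?thesis unfolding g_def using powr_ge_zero[of R "1 - s"] by linarith
  qed
  have g_cont: "continuous_on A (\<lambda>x. g (F x))" "continuous_on A (\<lambda>x. F x powr - s)"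
    if "continuous_on A F" "\<And>x. x \<in> A \<Longrightarrow> F x > 0" for A :: "'a set" and F
    unfolding g_def using that by (auto intro!: continuous_intros dest!: that(2))
  have v_cont: "continuous_on A v" for A
    using G(1) has_derivative_continuous continuous_at_imp_continuous_on by blast

  \<comment> \<open>\<open>W n b\<close> is the derivative along \<open>b\<close> of
    \<open>v * g(E)\<close>, and \<open>T n\<close> the inner product of the gradients of
    \<open>v * g(E)\<close> and \<open>E\<close>. \<open>H n b\<close> is the derivative of
    \<open>v * g(E) * P n b\<close>, so the \<open>H\<close> sum to \<open>T\<close> plus
    \<open>v * g(E)\<close> times the Laplacian of \<open>E\<close>. The former integrates to 0 and
    the latter is nonpositive, whence the integral of \<open>T\<close> is nonnegative.\<close>
  define W where "W n b x = (G x \<bullet> b) * g (E n x) + v x * ((1 - s) * E n x powr - s * P n b x)" for n b x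
  define T where "T n x = (\<Sum>b\<in>Basis. W n b x * P n b x)" for n x
  define H where "H n b x = W n b x * P n b x + v x * g (E n x) * Q n b x" for n b x
  have W_cont: "continuous_on K (W n b)" for n b
    unfolding W_def[abs_def]
    by (intro continuous_intros g_cont G v_cont P_cont E_cont E_pos)
  have T_cont: "continuous_on K (T n)" for n
    unfolding T_def[abs_def] by (intro continuous_intros W_cont P_cont)
  have H_cont: "continuous_on K (H n b)" for n b
    unfolding H_def[abs_def] by (intro continuous_intros W_cont P_cont g_cont E_cont E_pos v_cont Q_cont)
  have T_out: "T n x = 0" if "x \<notin> K" for n x using out[OF that] by (simp add: T_def W_def)
  have H_out: "H n b x = 0" if "x \<notin> K" for n b x using out[OF that] by (simp add: H_def W_def)
  note T_int = integrable_compact_support(1,2)[OF K(1) T_cont T_out]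
  note H_int = integrable_compact_support(1)[OF K(1) H_cont H_out]
  have H_integral: "(\<integral>x. H n b x \<partial>lborel) = 0" for n b
  proof (rule integral_directional_deriv_eq_0[OF K(1), where h="\<lambda>x. v x * g (E n x) * P n b x" and b=b])
    show "continuous_on K (\<lambda>x. v x * g (E n x) * P n b x)"
      by (intro continuous_intros P_cont g_cont E_cont E_pos v_cont)
    show "((\<lambda>t. v (x + t *\<^sub>R b) * g (E n (x + t *\<^sub>R b)) * P n b (x + t *\<^sub>R b)) has_real_derivative H n b x) (at 0)"
      if "x \<in> K" for x
    proof -
      have "((\<lambda>t. g (E n (x + t *\<^sub>R b))) has_real_derivative (1 - s) * E n x powr - s * P n b x) (at 0)"
        using DERIV_chain2[of g "(1 - s) * E n x powr - s" "\<lambda>t. E n (x + t *\<^sub>R b)" 0, OF _ E_der]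
          g_der[OF E_pos[OF that]] by simp
      from DERIV_mult[OF DERIV_mult[OF has_derivative_directional[OF G(1)[of x]] this] P_der]
      show ?thesis
        by (rule DERIV_cong) (simp add: H_def W_def algebra_simps)
    qed
  qed (use out H_cont H_out in auto)
  have T_integral: "0 \<le> (\<integral>x. T n x \<partial>lborel)" for n
  proof -
    have "0 = (\<integral>x. (\<Sum>b\<in>Basis. H n b x) \<partial>lborel)"
      using H_int H_integral by simp
    also have "\<dots> \<le> (\<integral>x. T n x \<partial>lborel)"
    proof (rule integral_mono)
      show "(\<Sum>b\<in>Basis. H n b x) \<le> T n x" for x
      proof (cases "x \<in> K")
        case True
        have "(\<Sum>b\<in>Basis. H n b x) = T n x + v x * g (E n x) * (\<Sum>b\<in>Basis. Q n b x)"
          by (simp add: H_def T_def sum.distrib sum_distrib_left)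
        moreover have "v x * g (E n x) * (\<Sum>b\<in>Basis. Q n b x) \<le> 0"
          using v0 g0[OF E_pos[OF True] E_upper] Q_sum[OF True]
          by (intro mult_nonneg_nonpos mult_nonneg_nonneg) auto
        ultimately show ?thesis by linarith
      qed (simp add: T_out H_out)
    qed (use H_int T_int in auto)
    finally show ?thesis .
  qed

  define J where "J x = indicator K x *\<^sub>R (norm (G x) * g (d x) - (s - 1) * (v x * d x powr - s))" for x
  have J_int: "integrable lborel J"
    unfolding J_def[abs_def]
    by (intro borel_integrable_compact K continuous_intros g_cont d_cont d_pos v_cont G)
  \<comment> \<open>Only an inequality survives: Cauchy-Schwarz replaces
    \<open>G x \<bullet> D\<close> by \<open>norm (G x)\<close>, while
    \<open>D \<bullet> D = 1\<close> makes the other term exact.\<close>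
  have "AE x in lborel. \<exists>l\<le>J x. (\<lambda>n. T n x) \<longlonglongrightarrow> l"
    using AE_infdist_has_unit_derivative[OF S]
  proof eventually_elim
    case (elim x)
    show ?case
    proof (cases "x \<in> K")
      case True
      then obtain D where D: "norm D = 1" "(d has_derivative (\<lambda>h. D \<bullet> h)) (at x)"
        using elim K(2) unfolding d_infdist by auto
      have "(\<lambda>n. E n x - d x) \<longlonglongrightarrow> 0"
        by (rule Lim_null_comparison[OF _ e(1)]) (simp add: E_close)
      then have E_lim: "(\<lambda>n. E n x) \<longlonglongrightarrow> d x" by (simp add: LIM_zero_iff)
      have P_lim: "(\<lambda>n. P n b x) \<longlonglongrightarrow> D \<bullet> b" for b
        using tendsto_divide[OF smear_partial_tendsto[OF lip bump_in_class D(2) e(2,1), of b] tendsto_const[of m]] m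
        by (simp add: P_def m_def[symmetric])
      define l where "l = (\<Sum>b\<in>Basis. ((G x \<bullet> b) * g (d x) + v x * ((1 - s) * d x powr - s * (D \<bullet> b))) * (D \<bullet> b))"
      have "(\<lambda>n. T n x) \<longlonglongrightarrow> l"
        unfolding T_def W_def g_def l_def
        by (intro tendsto_intros E_lim P_lim) (use d_pos[OF True] in auto)
      moreover have "l = (G x \<bullet> D) * g (d x) + v x * ((1 - s) * d x powr - s) * (D \<bullet> D)"
        unfolding euclidean_inner[of "G x" D] euclidean_inner[of D D] l_def
        by (simp add: sum_distrib_left sum_distrib_right sum.distrib[symmetric] algebra_simps)
      moreover have "(G x \<bullet> D) * g (d x) \<le> norm (G x) * g (d x)"
        using norm_cauchy_schwarz[of "G x" D] D(1) g0[OF d_pos[OF True]] R[of x]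
        by (intro mult_right_mono) (auto simp: d_def)
      moreover have "D \<bullet> D = 1" using D(1) by (simp add: dot_square_norm)
      ultimately have "l \<le> J x" using True by (simp add: J_def algebra_simps)
      then show ?thesis using \<open>(\<lambda>n. T n x) \<longlonglongrightarrow> l\<close> by blast
    qed (auto simp: T_out J_def)
  qed
  \<comment> \<open>\<open>lim\<close> names a measurable limit function; its values at points of
    divergence form a null-set matter.\<close>
  then have T_lim: "AE x in lborel. lim (\<lambda>n. T n x) \<le> J x" "AE x in lborel. (\<lambda>n. T n x) \<longlonglongrightarrow> lim (\<lambda>n. T n x)"
    by (auto elim!: eventually_mono simp: limI)

  obtain CG where CG: "\<And>x. x \<in> K \<Longrightarrow> norm (G x) \<le> CG"
    using compact_imp_bounded[OF compact_continuous_image[OF G(2) K(1)]] by (auto simp: bounded_iff)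
  obtain Cv where Cv: "\<And>x. x \<in> K \<Longrightarrow> v x \<le> Cv"
    using compact_imp_bounded[OF compact_continuous_image[OF v_cont K(1)]] v0 by (auto simp: bounded_iff)
  have CG0: "CG \<ge> 0" and Cv0: "Cv \<ge> 0"
    using CG[OF x0(1)] Cv[OF x0(1)] norm_ge_zero[of "G x0"] v0[of x0] by linarith+
  define CP where "CP = (\<lambda>b::'a. (\<integral>y. \<bar>partial_deriv b bump y\<bar> \<partial>lborel) / m)"
  have CP: "\<bar>P n b x\<bar> \<le> CP b" for n b x
    using divide_right_mono[OF smear_partial_bound[OF lip bump_in_class e(2), of n b x], of m] m
    by (simp add: P_def CP_def abs_mult)
  have CP0: "CP b \<ge> 0" for b using CP[of 0 b x0] by linarith
  define CW where "CW = (\<lambda>b::'a. CG * \<delta> powr (1 - s) + Cv * ((s - 1) * \<delta> powr - s * CP b))"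
  define C where "C = (\<Sum>b\<in>Basis. CW b * CP b)"
  \<comment> \<open>The bound is uniform in \<open>n\<close>: \<open>\<delta> \<le> E n x\<close>
    controls both powers, and \<open>CP\<close> comes from the derivative bound that does not depend
    on the radius.\<close>
  have T_bound: "\<bar>T n x\<bar> \<le> C" if x: "x \<in> K" for n x
  proof -
    have "\<bar>W n b x * P n b x\<bar> \<le> CW b * CP b" if b: "b \<in> Basis" for b
    proof -
      have "\<bar>G x \<bullet> b\<bar> \<le> CG" using Basis_le_norm[OF b, of "G x"] CG[OF x] by linarith
      then have "\<bar>(G x \<bullet> b) * g (E n x)\<bar> \<le> CG * \<delta> powr (1 - s)"
        unfolding abs_mult using g0[OF E_pos[OF x] E_upper, of n] g_upper[OF E_lower[OF x, of n]] CG0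
        by (intro mult_mono) auto
      moreover have "\<bar>v x * ((1 - s) * E n x powr - s * P n b x)\<bar> \<le> Cv * ((s - 1) * \<delta> powr - s * CP b)"
        unfolding abs_mult using v0[of x] Cv[OF x] Cv0 CP[of n b x] s E_lower[OF x, of n] \<delta>(1) CP0
        by (intro mult_mono) (auto intro!: powr_mono2')
      ultimately have "\<bar>W n b x\<bar> \<le> CW b"
        unfolding W_def CW_def by linarith
      then show ?thesis unfolding abs_mult using CP[of n b x] by (intro mult_mono) auto
    qed
    then show ?thesis
      unfolding T_def C_def by (intro order_trans[OF sum_abs] sum_mono) auto
  qed
  have "(\<lambda>n. \<integral>x. T n x \<partial>lborel) \<longlonglongrightarrow> (\<integral>x. lim (\<lambda>n. T n x) \<partial>lborel)"
    and lim_int: "integrable lborel (\<lambda>x. lim (\<lambda>n. T n x))"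
  proof -
    have meas: "(\<lambda>x. lim (\<lambda>n. T n x)) \<in> borel_measurable lborel" "\<And>n. T n \<in> borel_measurable lborel"
      using T_int(2) by (auto intro!: borel_measurable_lim_metric)
    have w: "integrable lborel (\<lambda>x. indicator K x *\<^sub>R C)"
      by (intro borel_integrable_compact K continuous_on_const)
    have bound: "AE x in lborel. norm (T n x) \<le> indicator K x *\<^sub>R C" for n
      using T_bound[of _ n] T_out[of _ n] by (auto simp: indicator_def)
    show "(\<lambda>n. \<integral>x. T n x \<partial>lborel) \<longlonglongrightarrow> (\<integral>x. lim (\<lambda>n. T n x) \<partial>lborel)"
      by (rule integral_dominated_convergence[OF meas w T_lim(2) bound])
    show "integrable lborel (\<lambda>x. lim (\<lambda>n. T n x))"
      by (rule integrable_dominated_convergence[OF meas w T_lim(2) bound])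
  qed
  then have "0 \<le> (\<integral>x. lim (\<lambda>n. T n x) \<partial>lborel)"
    using T_integral by (intro LIMSEQ_le_const) auto
  also have "\<dots> \<le> (\<integral>x. J x \<partial>lborel)"
    by (rule integral_mono_AE[OF lim_int J_int T_lim(1)])
  finally show ?thesis
    unfolding set_lebesgue_integral_def J_def d_def g_def .
qed

section \<open>Gradients of test functions and the passage from the regularised to the full
  inequality\<close>

lemma test_fun_has_derivative:
  fixes u :: "'a::euclidean_space \<Rightarrow> real"
  assumes "test_fun u \<Omega>"
  shows "(u has_derivative (\<lambda>h. grad u x \<bullet> h)) (at x)" "continuous_on A (grad u)"
proof -
  have smooth: "smooth_on u UNIV" using assms by (simp add: test_fun_def)
  then have "u differentiable (at x)"
    unfolding smooth_on_def differentiable_on_def using iter_partials.base by blast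
  then have u: "(u has_derivative frechet_derivative u (at x)) (at x)"
    by (simp add: frechet_derivative_works)
  have "frechet_derivative u (at x) h = grad u x \<bullet> h" for h
  proof -
    note lin = has_derivative_linear[OF u]
    have "frechet_derivative u (at x) h = frechet_derivative u (at x) (\<Sum>b\<in>Basis. (h \<bullet> b) *\<^sub>R b)"
      by (simp add: euclidean_representation)
    also have "\<dots> = (\<Sum>b\<in>Basis. (h \<bullet> b) * frechet_derivative u (at x) b)"
      by (simp add: linear_sum[OF lin] linear_cmul[OF lin])
    finally show ?thesis
      by (simp add: grad_def partial_deriv_def inner_sum_left inner_commute[of h] mult.commute)
  qed
  then show "(u has_derivative (\<lambda>h. grad u x \<bullet> h)) (at x)"
    using u by (metis (no_types, lifting) ext)
  have "continuous_on A (partial_deriv b u)" if "b \<in> Basis" for b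
    using smooth iter_partials.step[OF iter_partials.base that, of u]
    unfolding smooth_on_def by (meson continuous_on_subset subset_UNIV)
  then show "continuous_on A (grad u)"
    unfolding grad_def[abs_def] by (intro continuous_intros)
qed

text \<open>The weights may blow up at the boundary of \<open>\<Omega>\<close>; restricted to a
  compact set carrying \<open>u\<close>, the integrands are continuous, and the completed measure
  can be exchanged for the Borel one.\<close>

lemma set_integral_lebesgue_eq_compact:
  fixes f :: "'a::euclidean_space \<Rightarrow> real"
  assumes "compact K" "K \<subseteq> A" "continuous_on K f" "\<And>x. x \<notin> K \<Longrightarrow> f x = 0"
  shows "(\<integral>x\<in>A. f x \<partial>lebesgue) = (LBINT x:K. f x)" "set_integrable lborel K f"
proof -
  have eq: "(\<lambda>x. indicator A x *\<^sub>R f x) = (\<lambda>x. indicator K x *\<^sub>R f x)"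
    using assms(2,4) by (auto simp: indicator_def fun_eq_iff)
  have int: "integrable lborel (\<lambda>x. indicator K x *\<^sub>R f x)"
    by (rule borel_integrable_compact[OF assms(1,3)])
  then show "set_integrable lborel K f" by (simp add: set_integrable_def)
  show "(\<integral>x\<in>A. f x \<partial>lebesgue) = (LBINT x:K. f x)"
    unfolding set_lebesgue_integral_def eq
    by (rule integral_completion) (use int in \<open>auto dest: borel_measurable_integrable\<close>)
qed

theorem theorem2p13:
  fixes \<Omega> :: "'a::euclidean_space set" and u :: "'a \<Rightarrow> real" and s :: real
  assumes "open \<Omega>" and "\<Omega> \<noteq> UNIV"
    and "superharmonic_distr (dist_bd \<Omega>) \<Omega>"
    and "bdd_above (dist_bd \<Omega> ` \<Omega>)"
    and "test_fun u \<Omega>" and "s > 1"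
  shows "(\<integral>x\<in>\<Omega>. norm (grad u x) / dist_bd \<Omega> x powr (s - 1) \<partial>lebesgue)
         \<ge> (s - 1) * (\<integral>x\<in>\<Omega>. \<bar>u x\<bar> / dist_bd \<Omega> x powr s \<partial>lebesgue)
           + 1 / (SUP x\<in>\<Omega>. dist_bd \<Omega> x) powr (s - 1) * (\<integral>x\<in>\<Omega>. norm (grad u x) \<partial>lebesgue)"
proof (cases "\<Omega> = {}")
  case True
  then show ?thesis by (simp add: set_lebesgue_integral_def)
next
  case False
  define d where "d = dist_bd \<Omega>"
  define R where "R = (SUP x\<in>\<Omega>. d x)"
  define K where "K = closure {x. u x \<noteq> 0}"
  have K: "compact K" "K \<subseteq> \<Omega>" using assms(5) by (auto simp: test_fun_def K_def)
  have d_pos: "d x > 0" if "x \<in> \<Omega>" for x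
    unfolding d_def dist_bd_def using infdist_pos_not_in_closed[of "- \<Omega>" x] assms(1,2) that by auto
  have d_cont: "continuous_on A d" for A
    unfolding d_def dist_bd_def by (intro continuous_intros)
  have d_in: "d x \<le> R" if "x \<in> \<Omega>" for x
    unfolding R_def using assms(4) that by (intro cSUP_upper) (auto simp: d_def)
  obtain x0 where "x0 \<in> \<Omega>" using False by blast
  then have R0: "R > 0" using d_pos d_in by force
  \<comment> \<open>Outside \<open>\<Omega>\<close> the distance is 0, and \<open>R\<close> is
    positive because \<open>\<Omega>\<close> is nonempty.\<close>
  have R: "d x \<le> R" for x
    using d_in[of x] R0 by (cases "x \<in> \<Omega>") (auto simp: d_def dist_bd_def)
  note u_der = test_fun_has_derivative(1)[OF assms(5)]
  note grad_cont = test_fun_has_derivative(2)[OF assms(5)]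
  have u_cont: "continuous_on A u" for A
    by (intro continuous_at_imp_continuous_on ballI has_derivative_continuous[OF u_der])
  have u_out: "u x = 0" if "x \<notin> K" for x
    using that closure_subset[of "{x. u x \<noteq> 0}"] by (auto simp: K_def)
  have grad_out: "grad u x = 0" if "x \<notin> K" for x
  proof -
    have "((\<lambda>_. 0) has_derivative (\<lambda>h. grad u x \<bullet> h)) (at x)"
      by (rule has_derivative_transform_within_open[OF u_der, where s="- K"])
        (use that compact_imp_closed[OF K(1)] u_out in auto)
    from has_derivative_unique[OF this has_derivative_const]
    have "grad u x \<bullet> grad u x = 0" by meson
    then show ?thesis by simp
  qed
  have powr_cont: "continuous_on K (\<lambda>x. d x powr a)" for a
    using d_pos K(2) by (intro continuous_intros d_cont) force+

  \<comment> \<open>\<open>?X\<close> is the integrand of the final inequality brought to one side;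
    \<open>?Y\<close> is the coefficient of the error caused by regularising.\<close>
  let ?X = "\<lambda>x. norm (grad u x) * (d x powr (1 - s) - R powr (1 - s)) - (s - 1) * (\<bar>u x\<bar> * d x powr - s)"
  let ?Y = "\<lambda>x. (s - 1) * d x powr - s"
  have X_int: "set_integrable lborel K ?X" and Y_int: "set_integrable lborel K ?Y"
    unfolding set_integrable_def
    by (intro borel_integrable_compact K continuous_intros powr_cont grad_cont u_cont)+
  \<comment> \<open>Regularising costs at most \<open>\<delta>\<close> in the zeroth-order term, as
    \<open>\<bar>u\<bar> - \<delta> \<le> v\<close>, and nothing in the gradient term, as
    \<open>norm (G x) \<le> norm (grad u x)\<close>.\<close>
  have bound: "0 \<le> (LBINT x:K. ?X x) + \<delta> * (LBINT x:K. ?Y x)" if \<delta>: "\<delta> > 0" for \<delta>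
  proof -
    define r where "r x = sqrt ((u x)\<^sup>2 + \<delta>\<^sup>2)" for x
    \<comment> \<open>Subtracting \<open>\<delta>\<close> makes \<open>v\<close> vanish wherever
      \<open>u\<close> does, so the support stays in \<open>K\<close>.\<close>
    define v where "v x = r x - \<delta>" for x
    define G where "G x = (u x / r x) *\<^sub>R grad u x" for x
    have pos: "(u x)\<^sup>2 + \<delta>\<^sup>2 > 0" for x using \<delta> by (simp add: add_nonneg_pos)
    then have r: "r x > 0" for x by (simp add: r_def)
    have ur: "\<bar>u x\<bar> \<le> r x" for x
      using real_sqrt_le_mono[of "(u x)\<^sup>2" "(u x)\<^sup>2 + \<delta>\<^sup>2"] by (simp add: r_def)
    have r\<delta>: "\<delta> \<le> r x" for x
      using real_sqrt_le_mono[of "\<delta>\<^sup>2" "(u x)\<^sup>2 + \<delta>\<^sup>2"] \<delta> by (simp add: r_def)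
    have r_cont: "continuous_on A r" for A
      unfolding r_def[abs_def] by (intro continuous_intros u_cont)
    have G_cont: "continuous_on K G"
      unfolding G_def[abs_def] using r by (intro continuous_intros grad_cont u_cont r_cont) (metis less_irrefl)
    have v_der: "(v has_derivative (\<lambda>h. G x \<bullet> h)) (at x)" for x
    proof -
      have "((\<lambda>x. (u x)\<^sup>2 + \<delta>\<^sup>2) has_derivative (\<lambda>h. 2 * u x * (grad u x \<bullet> h))) (at x)"
        by (auto intro!: derivative_eq_intros u_der)
      from has_derivative_compose[OF this
          DERIV_real_sqrt[OF pos[of x], unfolded has_field_derivative_def]]
      have "((\<lambda>x. sqrt ((u x)\<^sup>2 + \<delta>\<^sup>2) - \<delta>) has_derivative
          (\<lambda>h. inverse (sqrt ((u x)\<^sup>2 + \<delta>\<^sup>2)) / 2 * (2 * u x * (grad u x \<bullet> h)) - 0)) (at x)"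
        by (intro has_derivative_diff has_derivative_const)
      then have "(v has_derivative (\<lambda>h. inverse (r x) / 2 * (2 * u x * (grad u x \<bullet> h)) - 0)) (at x)"
        unfolding r_def[symmetric] v_def[symmetric] .
      moreover have "(\<lambda>h. inverse (r x) / 2 * (2 * u x * (grad u x \<bullet> h)) - 0) = (\<lambda>h. G x \<bullet> h)"
        by (simp add: G_def field_simps)
      ultimately show ?thesis by (simp only:)
    qed
    have v_cont: "continuous_on K v"
      unfolding v_def[abs_def] by (intro continuous_intros r_cont)
    have "0 \<le> (LBINT x:K. norm (G x) * (d x powr (1 - s) - R powr (1 - s)) - (s - 1) * (v x * d x powr - s))"
      unfolding d_def
    proof (rule weighted_gradient_inequality[OF assms(1-3)])
      show "v x = 0" "G x = 0" if "x \<notin> K" for x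
        using u_out[OF that] \<delta> by (auto simp: v_def r_def G_def)
      show "0 \<le> v x" for x using r\<delta>[of x] by (simp add: v_def)
    qed (use R K v_der G_cont assms(6) in \<open>auto simp: d_def\<close>)
    also have "\<dots> \<le> (LBINT x:K. ?X x + \<delta> * ?Y x)"
    proof (rule set_integral_mono)
      show "set_integrable lborel K (\<lambda>x. norm (G x) * (d x powr (1 - s) - R powr (1 - s)) - (s - 1) * (v x * d x powr - s))"
        unfolding set_integrable_def
        by (intro borel_integrable_compact K continuous_intros powr_cont G_cont v_cont)
      show "set_integrable lborel K (\<lambda>x. ?X x + \<delta> * ?Y x)"
        by (intro set_integral_add X_int set_integrable_mult_right Y_int)
      fix x assume x: "x \<in> K"
      have "norm (G x) \<le> norm (grad u x)"
        using ur[of x] r[of x] mult_right_mono[of "\<bar>u x / r x\<bar>" 1 "norm (grad u x)"]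
        by (simp add: G_def)
      moreover have "R powr (1 - s) \<le> d x powr (1 - s)"
        using d_pos[of x] x K(2) R[of x] assms(6) by (intro powr_mono2') auto
      ultimately have "norm (G x) * (d x powr (1 - s) - R powr (1 - s))
          \<le> norm (grad u x) * (d x powr (1 - s) - R powr (1 - s))"
        by (intro mult_right_mono) auto
      moreover have "(\<bar>u x\<bar> - \<delta>) * ?Y x \<le> v x * ?Y x"
        using ur[of x] assms(6) by (intro mult_right_mono mult_nonneg_nonneg) (auto simp: v_def)
      ultimately show "norm (G x) * (d x powr (1 - s) - R powr (1 - s)) - (s - 1) * (v x * d x powr - s)
          \<le> ?X x + \<delta> * ?Y x"
        by (simp add: algebra_simps)
    qed
    also have "\<dots> = (LBINT x:K. ?X x) + \<delta> * (LBINT x:K. ?Y x)"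
      using X_int Y_int by (subst set_integral_add(2)) auto
    finally show ?thesis .
  qed
  have lim: "((\<lambda>\<delta>. (LBINT x:K. ?X x) + \<delta> * (LBINT x:K. ?Y x)) \<longlongrightarrow> (LBINT x:K. ?X x) + 0 * (LBINT x:K. ?Y x)) (at_right 0)"
    by (intro tendsto_intros)
  have "eventually (\<lambda>\<delta>. 0 \<le> (LBINT x:K. ?X x) + \<delta> * (LBINT x:K. ?Y x)) (at_right 0)"
    by (rule eventually_mono[OF eventually_at_right_less[of 0]]) (rule bound)
  from tendsto_lowerbound[OF lim this]
  have "0 \<le> (LBINT x:K. ?X x) + 0 * (LBINT x:K. ?Y x)" by simp
  then have X0: "0 \<le> (LBINT x:K. ?X x)" by simp
  \<comment> \<open>These hold at every \<open>x\<close>: where \<open>d x = 0\<close>, both sides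
    are 0 by the conventions for \<open>powr\<close> and division.\<close>
  have 1: "norm (grad u x) / d x powr (s - 1) = norm (grad u x) * d x powr (1 - s)" for x
    using powr_minus_divide[of "d x" "s - 1"] by simp
  have 2: "\<bar>u x\<bar> / d x powr s = \<bar>u x\<bar> * d x powr - s" for x
    using powr_minus_divide[of "d x" s] by simp
  have 3: "1 / R powr (s - 1) = R powr (1 - s)"
    using powr_minus_divide[of R "s - 1"] by simp
  have c1: "continuous_on K (\<lambda>x. norm (grad u x) * d x powr (1 - s))"
    and c2: "continuous_on K (\<lambda>x. \<bar>u x\<bar> * d x powr - s)"
    and c3: "continuous_on K (\<lambda>x. norm (grad u x))"
    by (intro continuous_intros grad_cont powr_cont u_cont)+
  note i1 = set_integral_lebesgue_eq_compact[OF K c1]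
    and i2 = set_integral_lebesgue_eq_compact[OF K c2]
    and i3 = set_integral_lebesgue_eq_compact[OF K c3]
  have "(LBINT x:K. ?X x) = (LBINT x:K. norm (grad u x) * d x powr (1 - s)
      - R powr (1 - s) * norm (grad u x) - (s - 1) * (\<bar>u x\<bar> * d x powr - s))"
    by (simp add: algebra_simps)
  also have "\<dots> = (LBINT x:K. norm (grad u x) * d x powr (1 - s))
      - R powr (1 - s) * (LBINT x:K. norm (grad u x)) - (s - 1) * (LBINT x:K. \<bar>u x\<bar> * d x powr - s)"
    using i1(2) i2(2) i3(2) grad_out u_out
    by (simp add: set_integral_diff)
  finally show ?thesis
    using X0 unfolding d_def[symmetric] R_def[symmetric] 1 2 3
    by (subst i1(1) i2(1) i3(1); simp add: grad_out u_out)+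
qed

end
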